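(* Let $G$ be a hereditarily $h$-complete topological group admitting a quasi-invariant basis. Then $G$ is the projective limit of its metrizable quotients.
   Context: All topological groups are assumed to be Hausdorff. A topological group $G$ is $h$-complete if for every continuous homomorphism $\varphi: G \rightarrow L$ into a topological group $L$, the image $\varphi(G)$ is closed in $L$. $G$ is hereditarily $h$-complete if every closed subgroup of $G$ is $h$-complete. A topological group $G$ has (admits) a quasi-invariant basis if for every neighborhood $U$ of the identity there exists a countable family $\mathcal{V}$ of neighborhoods of the identity such that for every $g \in G$ there exists $V \in \mathcal{V}$ with $g V g^{-1} \subset U$. The metrizable quotients of $G$ are the quotient groups $G/N$ with $N$ a closed normal subgroup of $G$ such that $G/N$ is metrizable. That $G$ is their projective limit means that these quotients, with the canonical maps $G/N \to G/N'$ for $N \subseteq N'$, form a projective (inverse) system, and the canonical homomorphism from $G$ to the limit of this system is an isomorphism of topological groups. *)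

theory Defs
  imports "HOL-Analysis.Analysis" "HOL-Algebra.Algebra"
begin

definition topological_group :: "('a, 'b) monoid_scheme \<Rightarrow> 'a topology \<Rightarrow> bool" where
  "topological_group G T \<longleftrightarrow>
     Group.group G \<and> topspace T = carrier G \<and>
     continuous_map (prod_topology T T) T (\<lambda>(x, y). x \<otimes>\<^bsub>G\<^esub> y) \<and>
     continuous_map T T (\<lambda>x. inv\<^bsub>G\<^esub> x) \<and>
     Hausdorff_space T"

text \<open>HOL cannot quantify over all types inside a definition, so the target group \<open>L\<close> ranges over
  the groups whose elements have type \<open>'a set set\<close>. This loses nothing: the closure of the image of
  \<open>G\<close> in a Hausdorff group embeds into \<open>'a set set\<close>, and lemma \<open>h_complete_imp_closedin\<close> below
  shows that the property holds for target groups over an arbitrary type.\<close>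

definition h_complete :: "('a, 'b) monoid_scheme \<Rightarrow> 'a topology \<Rightarrow> bool" where
  "h_complete G T \<longleftrightarrow>
     (\<forall>(L :: 'a set set monoid) S \<phi>.
        topological_group L S \<and> \<phi> \<in> hom G L \<and> continuous_map T S \<phi> \<longrightarrow>
        closedin S (\<phi> ` carrier G))"

definition hereditarily_h_complete :: "('a, 'b) monoid_scheme \<Rightarrow> 'a topology \<Rightarrow> bool" where
  "hereditarily_h_complete G T \<longleftrightarrow>
     (\<forall>H. subgroup H G \<and> closedin T H \<longrightarrow>
        h_complete (G\<lparr>carrier := H\<rparr>) (subtopology T H))"

definition neighbourhood :: "'a topology \<Rightarrow> 'a \<Rightarrow> 'a set \<Rightarrow> bool" where
  "neighbourhood T x V \<longleftrightarrow> V \<subseteq> topspace T \<and> (\<exists>W. openin T W \<and> x \<in> W \<and> W \<subseteq> V)"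

definition quasi_invariant_basis :: "('a, 'b) monoid_scheme \<Rightarrow> 'a topology \<Rightarrow> bool" where
  "quasi_invariant_basis G T \<longleftrightarrow>
     (\<forall>U. neighbourhood T \<one>\<^bsub>G\<^esub> U \<longrightarrow>
        (\<exists>\<V>. countable \<V> \<and> (\<forall>V\<in>\<V>. neighbourhood T \<one>\<^bsub>G\<^esub> V) \<and>
             (\<forall>g\<in>carrier G. \<exists>V\<in>\<V>. {g \<otimes>\<^bsub>G\<^esub> v \<otimes>\<^bsub>G\<^esub> inv\<^bsub>G\<^esub> g | v. v \<in> V} \<subseteq> U)))"

definition quotient_topology :: "('a, 'b) monoid_scheme \<Rightarrow> 'a topology \<Rightarrow> 'a set \<Rightarrow> 'a set topology" where
  "quotient_topology G T N =
     topology (\<lambda>\<U>. \<U> \<subseteq> rcosets\<^bsub>G\<^esub> N \<and> openin T {x \<in> topspace T. N #>\<^bsub>G\<^esub> x \<in> \<U>})"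

lemma openin_quotient_topology:
  "openin (quotient_topology G T N) \<U> \<longleftrightarrow>
     \<U> \<subseteq> rcosets\<^bsub>G\<^esub> N \<and> openin T {x \<in> topspace T. N #>\<^bsub>G\<^esub> x \<in> \<U>}"
proof -
  have "istopology (\<lambda>\<U>. \<U> \<subseteq> rcosets\<^bsub>G\<^esub> N \<and> openin T {x \<in> topspace T. N #>\<^bsub>G\<^esub> x \<in> \<U>})"
    unfolding istopology_def
  proof (intro conjI allI impI)
    fix S S'
    assume *: "S \<subseteq> rcosets\<^bsub>G\<^esub> N \<and> openin T {x \<in> topspace T. N #>\<^bsub>G\<^esub> x \<in> S}"
      "S' \<subseteq> rcosets\<^bsub>G\<^esub> N \<and> openin T {x \<in> topspace T. N #>\<^bsub>G\<^esub> x \<in> S'}"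
    show "S \<inter> S' \<subseteq> rcosets\<^bsub>G\<^esub> N" using * by blast
    have eq: "{x \<in> topspace T. N #>\<^bsub>G\<^esub> x \<in> S \<inter> S'} =
        {x \<in> topspace T. N #>\<^bsub>G\<^esub> x \<in> S} \<inter> {x \<in> topspace T. N #>\<^bsub>G\<^esub> x \<in> S'}" by blast
    show "openin T {x \<in> topspace T. N #>\<^bsub>G\<^esub> x \<in> S \<inter> S'}"
      unfolding eq by (rule openin_Int) (use * in simp_all)
  next
    fix \<K>
    assume *: "\<forall>K\<in>\<K>. K \<subseteq> rcosets\<^bsub>G\<^esub> N \<and> openin T {x \<in> topspace T. N #>\<^bsub>G\<^esub> x \<in> K}"
    show "\<Union>\<K> \<subseteq> rcosets\<^bsub>G\<^esub> N" using * by blast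
    have "{x \<in> topspace T. N #>\<^bsub>G\<^esub> x \<in> \<Union>\<K>} = (\<Union>K\<in>\<K>. {x \<in> topspace T. N #>\<^bsub>G\<^esub> x \<in> K})"
      by blast
    moreover have "openin T (\<Union>K\<in>\<K>. {x \<in> topspace T. N #>\<^bsub>G\<^esub> x \<in> K})"
      using * by blast
    ultimately show "openin T {x \<in> topspace T. N #>\<^bsub>G\<^esub> x \<in> \<Union>\<K>}" by simp
  qed
  then show ?thesis
    by (simp add: quotient_topology_def topology_inverse')
qed

definition metrizable_quotient_kernels :: "('a, 'b) monoid_scheme \<Rightarrow> 'a topology \<Rightarrow> 'a set set" where
  "metrizable_quotient_kernels G T =
     {N. N \<lhd> G \<and> closedin T N \<and> metrizable_space (quotient_topology G T N)}"

text \<open>The canonical map \<open>G/N \<rightarrow> G/N'\<close> for \<open>N \<subseteq> N'\<close>; it sends \<open>N x\<close> to \<open>N' N x = N' x\<close>.\<close>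

definition quotient_transition ::
    "('a, 'b) monoid_scheme \<Rightarrow> 'a set \<Rightarrow> 'a set \<Rightarrow> 'a set \<Rightarrow> 'a set" where
  "quotient_transition G N N' C = N' <#>\<^bsub>G\<^esub> C"

lemma quotient_transition_coset:
  assumes "N \<lhd> G" "N' \<lhd> G" "N \<subseteq> N'" "x \<in> carrier G"
  shows "quotient_transition G N N' (N #>\<^bsub>G\<^esub> x) = N' #>\<^bsub>G\<^esub> x"
proof -
  interpret N: normal N G by fact
  interpret N': normal N' G by fact
  have "N' <#>\<^bsub>G\<^esub> N = N'"
  proof
    show "N' <#>\<^bsub>G\<^esub> N \<subseteq> N'"
      using assms(3) by (auto simp: set_mult_def)
    show "N' \<subseteq> N' <#>\<^bsub>G\<^esub> N"
    proof
      fix y assume y: "y \<in> N'"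
      have "\<one>\<^bsub>G\<^esub> \<in> N" by (rule subgroup.one_closed[OF N.subgroup_axioms])
      then have "y \<otimes>\<^bsub>G\<^esub> \<one>\<^bsub>G\<^esub> \<in> N' <#>\<^bsub>G\<^esub> N"
        unfolding set_mult_def using y by blast
      then show "y \<in> N' <#>\<^bsub>G\<^esub> N" using N'.mem_carrier[OF y] by simp
    qed
  qed
  then show ?thesis
    using N.setmult_rcos_assoc[OF N'.subset N.subset assms(4)]
    by (simp add: quotient_transition_def)
qed

text \<open>An inverse system indexed by a directed preordered set; \<open>prec i j\<close> means that \<open>j\<close> is the
  larger index, and \<open>p j i\<close> is then the transition map from the \<open>j\<close>-th to the \<open>i\<close>-th group.\<close>

definition projective_system ::
    "'i set \<Rightarrow> ('i \<Rightarrow> 'i \<Rightarrow> bool) \<Rightarrow> ('i \<Rightarrow> ('a, 'b) monoid_scheme) \<Rightarrow> ('i \<Rightarrow> 'a topology) \<Rightarrow>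
     ('i \<Rightarrow> 'i \<Rightarrow> 'a \<Rightarrow> 'a) \<Rightarrow> bool" where
  "projective_system I prec Gs Ts p \<longleftrightarrow>
     I \<noteq> {} \<and>
     (\<forall>i\<in>I. prec i i) \<and>
     (\<forall>i\<in>I. \<forall>j\<in>I. \<forall>k\<in>I. prec i j \<and> prec j k \<longrightarrow> prec i k) \<and>
     (\<forall>i\<in>I. \<forall>j\<in>I. \<exists>k\<in>I. prec i k \<and> prec j k) \<and>
     (\<forall>i\<in>I. topological_group (Gs i) (Ts i)) \<and>
     (\<forall>i\<in>I. \<forall>j\<in>I. prec i j \<longrightarrow>
        p j i \<in> hom (Gs j) (Gs i) \<and> continuous_map (Ts j) (Ts i) (p j i)) \<and>
     (\<forall>i\<in>I. \<forall>x\<in>carrier (Gs i). p i i x = x) \<and>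
     (\<forall>i\<in>I. \<forall>j\<in>I. \<forall>k\<in>I. prec i j \<and> prec j k \<longrightarrow>
        (\<forall>x\<in>carrier (Gs k). p j i (p k j x) = p k i x))"

definition projective_limit_carrier ::
    "'i set \<Rightarrow> ('i \<Rightarrow> 'i \<Rightarrow> bool) \<Rightarrow> ('i \<Rightarrow> ('a, 'b) monoid_scheme) \<Rightarrow>
     ('i \<Rightarrow> 'i \<Rightarrow> 'a \<Rightarrow> 'a) \<Rightarrow> ('i \<Rightarrow> 'a) set" where
  "projective_limit_carrier I prec Gs p =
     {f \<in> (\<Pi>\<^sub>E i\<in>I. carrier (Gs i)). \<forall>i\<in>I. \<forall>j\<in>I. prec i j \<longrightarrow> p j i (f j) = f i}"

definition projective_limit_group ::
    "'i set \<Rightarrow> ('i \<Rightarrow> 'i \<Rightarrow> bool) \<Rightarrow> ('i \<Rightarrow> ('a, 'b) monoid_scheme) \<Rightarrow>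
     ('i \<Rightarrow> 'i \<Rightarrow> 'a \<Rightarrow> 'a) \<Rightarrow> ('i \<Rightarrow> 'a) monoid" where
  "projective_limit_group I prec Gs p =
     (product_group I Gs)\<lparr>carrier := projective_limit_carrier I prec Gs p\<rparr>"

definition projective_limit_topology ::
    "'i set \<Rightarrow> ('i \<Rightarrow> 'i \<Rightarrow> bool) \<Rightarrow> ('i \<Rightarrow> ('a, 'b) monoid_scheme) \<Rightarrow> ('i \<Rightarrow> 'a topology) \<Rightarrow>
     ('i \<Rightarrow> 'i \<Rightarrow> 'a \<Rightarrow> 'a) \<Rightarrow> ('i \<Rightarrow> 'a) topology" where
  "projective_limit_topology I prec Gs Ts p =
     subtopology (product_topology Ts I) (projective_limit_carrier I prec Gs p)"

definition topological_group_iso ::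
    "('a, 'c) monoid_scheme \<Rightarrow> 'a topology \<Rightarrow> ('b, 'd) monoid_scheme \<Rightarrow> 'b topology \<Rightarrow> ('a \<Rightarrow> 'b) \<Rightarrow> bool" where
  "topological_group_iso G T H S f \<longleftrightarrow> f \<in> iso G H \<and> homeomorphic_map T S f"

definition projective_limit_of_metrizable_quotients ::
    "('a, 'b) monoid_scheme \<Rightarrow> 'a topology \<Rightarrow> bool" where
  "projective_limit_of_metrizable_quotients G T \<longleftrightarrow>
     (let I = metrizable_quotient_kernels G T;
          prec = (\<lambda>N' N. N \<subseteq> N');
          Gs = (\<lambda>N. G Mod N);
          Ts = quotient_topology G T;
          p = quotient_transition G
      in projective_system I prec Gs Ts p \<and>
         topological_group_iso G T
           (projective_limit_group I prec Gs p) (projective_limit_topology I prec Gs Ts p)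
           (\<lambda>x. \<lambda>N\<in>I. N #>\<^bsub>G\<^esub> x))"

lemma h_complete_imp_closedin:
  fixes G :: "('a, 'b) monoid_scheme" and L :: "('c, 'd) monoid_scheme"
  assumes G: "topological_group G T" and hc: "h_complete G T"
    and L: "topological_group L S"
    and hom: "\<phi> \<in> hom G L" and cont: "continuous_map T S \<phi>"
  shows "closedin S (\<phi> ` carrier G)"
proof -
  define D where "D = \<phi> ` carrier G"
  define C where "C = Abstract_Topology.closure_of S D"
  have grpG: "Group.group G" and grpL: "Group.group L" and topS: "topspace S = carrier L"
    and topT: "topspace T = carrier G"
    and multL: "continuous_map (prod_topology S S) S (\<lambda>(x, y). x \<otimes>\<^bsub>L\<^esub> y)"
    and invL: "continuous_map S S (\<lambda>x. inv\<^bsub>L\<^esub> x)" and T2: "Hausdorff_space S"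
    using G L by (auto simp: topological_group_def)
  interpret L: Group.group L by fact
  interpret gh: group_hom G L \<phi>
    using grpG grpL hom by (simp add: group_hom_def group_hom_axioms_def)
  have subD: "subgroup D L"
    unfolding D_def by (rule gh.img_is_subgroup)
  have Dsub: "D \<subseteq> topspace S" using subgroup.subset[OF subD] topS by simp
  have CsubL: "C \<subseteq> carrier L" using closure_of_subset_topspace[of S D] topS by (simp add: C_def)
  have DC: "D \<subseteq> C" unfolding C_def by (rule closure_of_subset[OF Dsub])
  have Cm: "x \<otimes>\<^bsub>L\<^esub> y \<in> C" if "x \<in> C" "y \<in> C" for x y
  proof -
    have "(x, y) \<in> Abstract_Topology.closure_of (prod_topology S S) (D \<times> D)"
      using that by (simp add: closure_of_Times C_def)
    then have "x \<otimes>\<^bsub>L\<^esub> y \<in> Abstract_Topology.closure_of S ((\<lambda>(x, y). x \<otimes>\<^bsub>L\<^esub> y) ` (D \<times> D))"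
      using continuous_map_image_closure_subset[OF multL, of "D \<times> D"] by force
    moreover have "(\<lambda>(x, y). x \<otimes>\<^bsub>L\<^esub> y) ` (D \<times> D) \<subseteq> D"
      using subgroup.m_closed[OF subD] by auto
    ultimately show ?thesis unfolding C_def using closure_of_mono by blast
  qed
  have Ci: "inv\<^bsub>L\<^esub> x \<in> C" if "x \<in> C" for x
  proof -
    have "inv\<^bsub>L\<^esub> x \<in> Abstract_Topology.closure_of S ((\<lambda>x. inv\<^bsub>L\<^esub> x) ` D)"
      using continuous_map_image_closure_subset[OF invL, of D] that by (force simp: C_def)
    moreover have "(\<lambda>x. inv\<^bsub>L\<^esub> x) ` D \<subseteq> D"
      using subgroup.m_inv_closed[OF subD] by auto
    ultimately show ?thesis unfolding C_def using closure_of_mono by blast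
  qed
  have C1: "\<one>\<^bsub>L\<^esub> \<in> C" using subgroup.one_closed[OF subD] DC by blast
  define e :: "'c \<Rightarrow> 'a set set"
    where "e x = {A. A \<subseteq> carrier G \<and> x \<in> Abstract_Topology.closure_of S (\<phi> ` A)}" for x
  have inj: "inj_on e C"
  proof (rule inj_onI, rule ccontr)
    fix x y assume xy: "x \<in> C" "y \<in> C" "e x = e y" "x \<noteq> y"
    then obtain U V where UV: "openin S U" "openin S V" "x \<in> U" "y \<in> V" "disjnt U V"
      using T2 CsubL topS unfolding Hausdorff_space_def by (metis subsetD)
    define A where "A = {g \<in> carrier G. \<phi> g \<in> U}"
    have "x \<in> Abstract_Topology.closure_of S (\<phi> ` A)"
    proof (subst in_closure_of, intro conjI allI impI)
      show "x \<in> topspace S" using xy(1) CsubL topS by blast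
      fix W assume W: "x \<in> W \<and> openin S W"
      then have "openin S (U \<inter> W)" "x \<in> U \<inter> W" using UV by auto
      then obtain d where "d \<in> D" "d \<in> U \<inter> W"
        using xy(1) unfolding C_def in_closure_of by blast
      then show "\<exists>y. y \<in> \<phi> ` A \<and> y \<in> W" by (auto simp: D_def A_def)
    qed
    then have "A \<in> e x" by (auto simp: e_def A_def)
    then have "y \<in> Abstract_Topology.closure_of S (\<phi> ` A)" using xy(3) by (auto simp: e_def)
    then obtain z where "z \<in> \<phi> ` A" "z \<in> V"
      using UV unfolding in_closure_of by blast
    then show False using UV(5) by (auto simp: A_def disjnt_def)
  qed
  define r where "r = inv_into C e"
  have re: "r (e x) = x" if "x \<in> C" for x using that inj by (simp add: r_def)
  define L' :: "'a set set monoid" where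
    "L' = \<lparr>carrier = e ` C, monoid.mult = (\<lambda>a b. e (r a \<otimes>\<^bsub>L\<^esub> r b)), one = e \<one>\<^bsub>L\<^esub>\<rparr>"
  define S' where "S' = pullback_topology (e ` C) r (subtopology S C)"
  have inC: "x \<in> carrier L" if "x \<in> C" for x using that CsubL by blast
  have grpL': "Group.group L'"
    by (rule groupI) (auto simp: L'_def re Cm C1 inC L.m_assoc intro!: bexI[OF _ Ci])
  have topS': "topspace S' = carrier L'"
    using CsubL by (auto simp: S'_def L'_def topspace_pullback_topology re topS)
  have invL': "inv\<^bsub>L'\<^esub> a = e (inv\<^bsub>L\<^esub> (r a))" if "a \<in> carrier L'" for a
  proof (rule group.inv_equality[OF grpL' _ that])
    show "e (inv\<^bsub>L\<^esub> (r a)) \<otimes>\<^bsub>L'\<^esub> a = \<one>\<^bsub>L'\<^esub>" "e (inv\<^bsub>L\<^esub> (r a)) \<in> carrier L'"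
      using that by (auto simp: L'_def re Ci inC)
  qed
  have cr: "continuous_map S' (subtopology S C) r"
    using continuous_map_pullback[OF continuous_map_id, of "e ` C" r "subtopology S C"]
    by (simp add: S'_def)
  then have crS: "continuous_map S' S r" by (simp add: continuous_map_in_subtopology)
  have ce: "continuous_map (subtopology S C) S' e"
    unfolding S'_def
  proof (rule continuous_map_pullback')
    show "continuous_map (subtopology S C) (subtopology S C) (r \<circ> e)"
      by (rule continuous_map_eq[OF continuous_map_id]) (auto simp: re)
    show "topspace (subtopology S C) \<subseteq> e -` e ` C" by auto
  qed
  have rC: "r a \<in> C" if "a \<in> carrier L'" for a
    using that by (auto simp: L'_def re)
  have "continuous_map (prod_topology S' S') S' (e \<circ> (\<lambda>(a, b). r a \<otimes>\<^bsub>L\<^esub> r b))"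
  proof (rule continuous_map_compose[OF _ ce])
    have "continuous_map (prod_topology S' S') (prod_topology S S) (\<lambda>(a, b). (r a, r b))"
      using crS by (simp add: continuous_map_prod_top)
    from continuous_map_compose[OF this multL]
    have "continuous_map (prod_topology S' S') S (\<lambda>(a, b). r a \<otimes>\<^bsub>L\<^esub> r b)"
      by (simp add: o_def split_def)
    then show "continuous_map (prod_topology S' S') (subtopology S C) (\<lambda>(a, b). r a \<otimes>\<^bsub>L\<^esub> r b)"
      by (auto simp: continuous_map_in_subtopology topS' rC Cm)
  qed
  then have multL': "continuous_map (prod_topology S' S') S' (\<lambda>(a, b). a \<otimes>\<^bsub>L'\<^esub> b)"
    by (simp add: o_def split_def L'_def)
  have "continuous_map S' S' (e \<circ> (\<lambda>a. inv\<^bsub>L\<^esub> (r a)))"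
  proof (rule continuous_map_compose[OF _ ce])
    show "continuous_map S' (subtopology S C) (\<lambda>a. inv\<^bsub>L\<^esub> (r a))"
      using continuous_map_compose[OF crS invL]
      by (auto simp: continuous_map_in_subtopology topS' rC Ci o_def)
  qed
  then have invcL': "continuous_map S' S' (\<lambda>a. inv\<^bsub>L'\<^esub> a)"
    by (rule continuous_map_eq) (simp add: topS' invL')
  have "inj_on r (topspace S')"
    by (auto simp: topS' L'_def inj_on_def re)
  then have T2': "Hausdorff_space S'"
    using Hausdorff_space_injective_preimage[OF T2 crS] by blast
  have L'top: "topological_group L' S'"
    unfolding topological_group_def using grpL' topS' multL' invcL' T2' by blast
  have \<phi>C: "\<phi> x \<in> C" if "x \<in> carrier G" for x
    using that DC by (auto simp: D_def)
  have hom': "e \<circ> \<phi> \<in> hom G L'"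
    by (rule homI) (auto simp: L'_def \<phi>C re gh.hom_mult)
  have cont': "continuous_map T S' (e \<circ> \<phi>)"
    by (rule continuous_map_compose[OF _ ce])
      (use cont topT \<phi>C in \<open>auto simp: continuous_map_in_subtopology\<close>)
  have "closedin S' ((e \<circ> \<phi>) ` carrier G)"
    using hc L'top hom' cont' unfolding h_complete_def by blast
  then have "closedin (subtopology S C)
      {x \<in> topspace (subtopology S C). e x \<in> (e \<circ> \<phi>) ` carrier G}"
    by (rule closedin_continuous_map_preimage[OF ce])
  moreover have "{x \<in> topspace (subtopology S C). e x \<in> (e \<circ> \<phi>) ` carrier G} = D"
  proof
    show "{x \<in> topspace (subtopology S C). e x \<in> (e \<circ> \<phi>) ` carrier G} \<subseteq> D"
    proof
      fix x assume "x \<in> {x \<in> topspace (subtopology S C). e x \<in> (e \<circ> \<phi>) ` carrier G}"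
      then obtain g where "x \<in> C" "g \<in> carrier G" "e x = e (\<phi> g)" by auto
      then have "x = \<phi> g" using inj_onD[OF inj] \<phi>C by blast
      then show "x \<in> D" using \<open>g \<in> carrier G\<close> by (simp add: D_def)
    qed
    show "D \<subseteq> {x \<in> topspace (subtopology S C). e x \<in> (e \<circ> \<phi>) ` carrier G}"
    proof
      fix x assume "x \<in> D"
      then obtain g where "g \<in> carrier G" "x = \<phi> g" by (auto simp: D_def)
      moreover have "x \<in> topspace (subtopology S C)"
        using \<open>x \<in> D\<close> DC Dsub by (auto simp: topspace_subtopology)
      ultimately show "x \<in> {x \<in> topspace (subtopology S C). e x \<in> (e \<circ> \<phi>) ` carrier G}"
        by auto
    qed
  qed
  ultimately have "closedin (subtopology S C) D" by simp
  moreover have "closedin S C" by (simp add: C_def)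
  ultimately have "closedin S D" by (rule closedin_trans_full)
  then show ?thesis by (simp add: D_def)
qed

end

theory Submission
  imports Defs
begin

text \<open>
  The canonical map from \<open>G\<close> to the limit of its metrizable quotients is injective with dense image as
  soon as \<open>G\<close> has enough of these quotients, and its image is closed because \<open>G\<close> is
  \<open>h\<close>-complete. The point is therefore to produce, inside every neighbourhood of the identity, a
  closed normal subgroup \<open>N\<close> such that \<open>G/N\<close> is metrizable in the quotient topology and a
  neighbourhood of the identity in \<open>G/N\<close> pulls back into the given neighbourhood.

  A quasi-invariant basis yields continuous homomorphisms from \<open>G\<close> to metrizable groups that
  control any given neighbourhood (\<open>nbhd_filtration_exists\<close>). Such a homomorphism induces a coarser
  metrizable topology on \<open>G/N\<close>, where \<open>N\<close> is its kernel, and one has to show that it is the quotient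
  topology, i.e. that the homomorphism is open. For this it is compared with a second, finer
  homomorphism of the same kind (\<open>open_mapping\<close>). A failure of openness is witnessed by a sequence,
  hence happens on a closed separable subgroup \<open>S\<close>, which is again \<open>h\<close>-complete. Its images in the two
  metrizable groups are closed in their completions, hence completely metrizable and separable, and
  the classical open mapping argument for Polish groups applies: Baire category shows that images
  of neighbourhoods are dense near the identity (\<open>almost_open\<close>), and a successive approximation
  shows that they contain neighbourhoods (\<open>alternating_approximation\<close>). A one-sided invariant metric
  on such a group need not be complete, so the approximation works with two sequences that are
  refined in turn.

  Maps to metrizable groups are encoded on \<open>G\<close> itself by decreasing sequences \<open>W\<close> of symmetric sets
  containing the identity (\<open>group_filtration\<close>). The completion of the corresponding quotient is the
  group of Cauchy sequences modulo null sequences. It serves only as a target group in which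
  \<open>h\<close>-completeness of \<open>S\<close> forces Cauchy sequences in \<open>S\<close> to converge
  (\<open>h_complete_imp_Cauchy_convergent\<close>).
\<close>

section \<open>Groups filtered by a sequence of identity neighbourhoods\<close>

context group
begin

lemma inv_mult_cancel:
  assumes "x \<in> carrier G" "y \<in> carrier G"
  shows "inv x \<otimes> (x \<otimes> y) = y" "x \<otimes> (inv x \<otimes> y) = y"
  using assms by (simp_all add: m_assoc[symmetric])

lemmas group_normalize = m_assoc inv_mult_group inv_mult_cancel

end

text \<open>A countable base at the identity of a group topology, kept apart from any topology: the sets are
  nested, symmetric, and every conjugate of a member contains a later member. Nothing forces the
  intersection to be trivial, so the topology it generates may fail to be Hausdorff. This is the
  form in which all maps to metrizable groups enter: such a map is represented by the preimages in
  \<open>G\<close> of a base at the identity.\<close>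

locale group_filtration = group G for G (structure) +
  fixes W :: "nat \<Rightarrow> 'a set"
  assumes W_carrier: "W n \<subseteq> carrier G"
    and W_one: "\<one> \<in> W n"
    and W_inv: "x \<in> W n \<Longrightarrow> inv x \<in> W n"
    and W_mult: "\<lbrakk>x \<in> W (Suc n); y \<in> W (Suc n)\<rbrakk> \<Longrightarrow> x \<otimes> y \<in> W n"
    and W_conj: "g \<in> carrier G \<Longrightarrow> \<exists>m. \<forall>w\<in>W m. g \<otimes> w \<otimes> inv g \<in> W n"
begin

lemma W_closed [simp]: "x \<in> W n \<Longrightarrow> x \<in> carrier G"
  using W_carrier by blast

lemma W_Suc: "x \<in> W (Suc n) \<Longrightarrow> x \<in> W n"
  using W_mult[OF _ W_one] by fastforce

lemma W_antimono: "m \<le> n \<Longrightarrow> W n \<subseteq> W m"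
  by (induction n rule: dec_induct) (auto dest: W_Suc)

lemma W_mono: "\<lbrakk>x \<in> W n; m \<le> n\<rbrakk> \<Longrightarrow> x \<in> W m"
  using W_antimono by blast

lemma W_mult3:
  assumes "x \<in> W (n + 2)" "y \<in> W (n + 2)" "z \<in> W (n + 2)"
  shows "x \<otimes> y \<otimes> z \<in> W n"
proof -
  have "x \<otimes> y \<in> W (Suc n)" "z \<in> W (Suc n)" using assms W_mult W_Suc by auto
  then show ?thesis by (rule W_mult)
qed

lemma W_conj_ge:
  assumes "g \<in> carrier G"
  obtains m where "m \<ge> k" "\<And>w. w \<in> W m \<Longrightarrow> g \<otimes> w \<otimes> inv g \<in> W n"
proof -
  obtain m where m: "\<forall>w\<in>W m. g \<otimes> w \<otimes> inv g \<in> W n" using W_conj assms by blast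
  show ?thesis
  proof (rule that)
    show "max k m \<ge> k" by simp
    show "g \<otimes> w \<otimes> inv g \<in> W n" if "w \<in> W (max k m)" for w
      using m W_mono[OF that, of m] by simp
  qed
qed

lemma W_conj_inv_ge:
  assumes "g \<in> carrier G"
  obtains m where "m \<ge> k" "\<And>w. w \<in> W m \<Longrightarrow> inv g \<otimes> w \<otimes> g \<in> W n"
  using W_conj_ge[of "inv g" k n] assms by auto

definition filtration_topology :: "'a topology" where
  "filtration_topology =
     topology (\<lambda>O'. O' \<subseteq> carrier G \<and> (\<forall>x\<in>O'. \<exists>n. \<forall>w\<in>W n. x \<otimes> w \<in> O'))"

lemma openin_filtration_topology:
  "openin filtration_topology O' \<longleftrightarrow>
     O' \<subseteq> carrier G \<and> (\<forall>x\<in>O'. \<exists>n. \<forall>w\<in>W n. x \<otimes> w \<in> O')"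
proof -
  have "istopology (\<lambda>O'. O' \<subseteq> carrier G \<and> (\<forall>x\<in>O'. \<exists>n. \<forall>w\<in>W n. x \<otimes> w \<in> O'))"
    unfolding istopology_def
  proof (intro conjI allI impI ballI)
    fix A B x
    assume A: "A \<subseteq> carrier G \<and> (\<forall>x\<in>A. \<exists>n. \<forall>w\<in>W n. x \<otimes> w \<in> A)"
      and B: "B \<subseteq> carrier G \<and> (\<forall>x\<in>B. \<exists>n. \<forall>w\<in>W n. x \<otimes> w \<in> B)"
    then show "A \<inter> B \<subseteq> carrier G" by blast
    assume "x \<in> A \<inter> B"
    then obtain m n where mn: "\<forall>w\<in>W m. x \<otimes> w \<in> A" "\<forall>w\<in>W n. x \<otimes> w \<in> B"
      using A B by blast
    then have "\<forall>w\<in>W (max m n). x \<otimes> w \<in> A \<inter> B"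
      using W_antimono[of m "max m n"] W_antimono[of n "max m n"] by auto
    then show "\<exists>n. \<forall>w\<in>W n. x \<otimes> w \<in> A \<inter> B" by blast
  next
    fix \<K> x
    assume *: "\<forall>K\<in>\<K>. K \<subseteq> carrier G \<and> (\<forall>x\<in>K. \<exists>n. \<forall>w\<in>W n. x \<otimes> w \<in> K)"
    then show "\<Union>\<K> \<subseteq> carrier G" by blast
    assume "x \<in> \<Union>\<K>"
    with * show "\<exists>n. \<forall>w\<in>W n. x \<otimes> w \<in> \<Union>\<K>" by (metis UnionE UnionI)
  qed
  then show ?thesis
    by (simp add: filtration_topology_def topology_inverse')
qed

lemma topspace_filtration_topology [simp]: "topspace filtration_topology = carrier G"
proof -
  have "openin filtration_topology (carrier G)"
    by (auto simp: openin_filtration_topology)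
  moreover have "topspace filtration_topology \<subseteq> carrier G"
    using openin_topspace[of filtration_topology] openin_filtration_topology by blast
  ultimately show ?thesis using openin_subset by blast
qed

text \<open>A translate of \<open>W n\<close> is a neighbourhood of its centre without being open; the witness is its
  interior.\<close>

lemma filtration_open_neighbourhood:
  assumes x: "x \<in> carrier G"
  obtains O' where "openin filtration_topology O'" "x \<in> O'"
    "\<And>y. y \<in> O' \<Longrightarrow> y \<in> carrier G \<and> inv x \<otimes> y \<in> W n"
proof -
  define O' where "O' = {y \<in> carrier G. \<exists>m. \<forall>w\<in>W m. inv x \<otimes> (y \<otimes> w) \<in> W n}"
  have "openin filtration_topology O'"
    unfolding openin_filtration_topology
  proof (intro conjI ballI)
    fix y assume "y \<in> O'"
    then obtain m where y: "y \<in> carrier G" and m: "\<forall>w\<in>W m. inv x \<otimes> (y \<otimes> w) \<in> W n"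
      by (auto simp: O'_def)
    have "y \<otimes> w \<in> O'" if w: "w \<in> W (Suc m)" for w
    proof -
      have "inv x \<otimes> (y \<otimes> w \<otimes> v) \<in> W n" if "v \<in> W (Suc m)" for v
        using m W_mult[OF w that] y w that by (simp add: m_assoc)
      then show ?thesis using y w by (auto simp: O'_def)
    qed
    then show "\<exists>n. \<forall>w\<in>W n. y \<otimes> w \<in> O'" by blast
  qed (auto simp: O'_def)
  moreover have "x \<in> O'"
    using x by (simp add: O'_def inv_mult_cancel) blast
  moreover have "inv x \<otimes> y \<in> W n" if y: "y \<in> O'" for y
  proof -
    obtain m where m: "y \<in> carrier G" "\<forall>w\<in>W m. inv x \<otimes> (y \<otimes> w) \<in> W n"
      using y unfolding O'_def by blast
    have "inv x \<otimes> (y \<otimes> \<one>) \<in> W n" using m(2) W_one by (rule bspec)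
    then show ?thesis using m(1) by simp
  qed
  moreover have "O' \<subseteq> carrier G" by (auto simp: O'_def)
  ultimately show ?thesis using that by blast
qed

text \<open>Writing \<open>a = x p\<close> and \<open>b = y q\<close>, the product is \<open>a b = x y (y\<^sup>-\<^sup>1 p y) q\<close>, so the conjugation
  axiom makes \<open>a b\<close> close to \<open>x y\<close>.\<close>

lemma continuous_map_filtration_mult:
  "continuous_map (prod_topology filtration_topology filtration_topology) filtration_topology
     (\<lambda>(x, y). x \<otimes> y)"
  unfolding continuous_map_def
proof (intro conjI allI impI)
  fix U assume U: "openin filtration_topology U"
  let ?P = "{p \<in> topspace (prod_topology filtration_topology filtration_topology).
               (case p of (x, y) \<Rightarrow> x \<otimes> y) \<in> U}"
  show "openin (prod_topology filtration_topology filtration_topology) ?P"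
    unfolding openin_prod_topology_alt
  proof (intro allI impI)
    fix x y assume "(x, y) \<in> ?P"
    then have xy: "x \<in> carrier G" "y \<in> carrier G" "x \<otimes> y \<in> U" by auto
    then obtain n where n: "\<And>w. w \<in> W n \<Longrightarrow> x \<otimes> y \<otimes> w \<in> U"
      using U unfolding openin_filtration_topology by blast
    obtain m where m: "\<And>w. w \<in> W m \<Longrightarrow> inv y \<otimes> w \<otimes> y \<in> W (Suc n)"
      using W_conj_inv_ge[OF xy(2), of 0] by blast
    obtain A where A: "openin filtration_topology A" "x \<in> A"
      "\<And>z. z \<in> A \<Longrightarrow> z \<in> carrier G \<and> inv x \<otimes> z \<in> W m"
      using filtration_open_neighbourhood[OF xy(1)] by metis
    obtain B where B: "openin filtration_topology B" "y \<in> B"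
      "\<And>z. z \<in> B \<Longrightarrow> z \<in> carrier G \<and> inv y \<otimes> z \<in> W (Suc n)"
      using filtration_open_neighbourhood[OF xy(2)] by metis
    have "a \<otimes> b \<in> U" if "a \<in> A" "b \<in> B" for a b
    proof -
      have "inv y \<otimes> (inv x \<otimes> a) \<otimes> y \<otimes> (inv y \<otimes> b) \<in> W n"
        using A(3)[OF that(1)] B(3)[OF that(2)] m by (intro W_mult[of _ n]) blast+
      then have "x \<otimes> y \<otimes> (inv y \<otimes> (inv x \<otimes> a) \<otimes> y \<otimes> (inv y \<otimes> b)) \<in> U" by (rule n)
      then show ?thesis
        using A(3)[OF that(1)] B(3)[OF that(2)] xy by (simp add: group_normalize)
    qed
    then have "A \<times> B \<subseteq> ?P" using A(3) B(3) by auto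
    then show "\<exists>A B. openin filtration_topology A \<and> openin filtration_topology B \<and>
        x \<in> A \<and> y \<in> B \<and> A \<times> B \<subseteq> ?P"
      using A B by blast
  qed
qed auto

lemma continuous_map_filtration_inv:
  "continuous_map filtration_topology filtration_topology (\<lambda>x. inv x)"
  unfolding continuous_map_def
proof (intro conjI allI impI)
  fix U assume U: "openin filtration_topology U"
  show "openin filtration_topology {x \<in> topspace filtration_topology. inv x \<in> U}"
    unfolding openin_filtration_topology
  proof (intro conjI ballI)
    fix x assume "x \<in> {x \<in> topspace filtration_topology. inv x \<in> U}"
    then have x: "x \<in> carrier G" "inv x \<in> U" by auto
    then obtain n where n: "\<And>w. w \<in> W n \<Longrightarrow> inv x \<otimes> w \<in> U"
      using U unfolding openin_filtration_topology by blast
    obtain m where m: "\<And>w. w \<in> W m \<Longrightarrow> x \<otimes> w \<otimes> inv x \<in> W n"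
      using W_conj_ge[OF x(1), of 0] by blast
    have "inv (x \<otimes> w) \<in> U" if w: "w \<in> W m" for w
      using n[OF m[OF W_inv[OF w]]] x w by (simp add: group_normalize)
    then show "\<exists>n. \<forall>w\<in>W n. x \<otimes> w \<in> {x \<in> topspace filtration_topology. inv x \<in> U}"
      using x by auto
  qed auto
qed auto

end

section \<open>Metrizability\<close>

text \<open>The combinatorial core of the Birkhoff--Kakutani theorem. The cut is made at the first entry \<open>k\<close>
  whose remainder \<open>bs\<close> is lighter than \<open>h'\<close>. Unless \<open>as\<close> is empty, \<open>k # bs\<close> then weighs at least
  \<open>h'\<close>, so that \<open>as\<close> is lighter than \<open>h\<close>.\<close>

lemma halving_split:
  fixes t :: "nat \<Rightarrow> real"
  assumes "ns \<noteq> []" "(\<Sum>n\<leftarrow>ns. t n) < h + h'" "h > 0" "h' > 0"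
  shows "\<exists>as k bs. ns = as @ k # bs \<and> (\<Sum>n\<leftarrow>as. t n) < h \<and> (\<Sum>n\<leftarrow>bs. t n) < h'"
  using assms
proof (induction ns arbitrary: h)
  case (Cons k ms)
  show ?case
  proof (cases "(\<Sum>n\<leftarrow>ms. t n) < h'")
    case True
    then show ?thesis using Cons.prems by (intro exI[of _ "[]"]) auto
  next
    case False
    then have "ms \<noteq> []" "(\<Sum>n\<leftarrow>ms. t n) < (h - t k) + h'" "h - t k > 0"
      using Cons.prems by auto
    from Cons.IH[OF this Cons.prems(4)] obtain as j bs where
      "ms = as @ j # bs" "(\<Sum>n\<leftarrow>as. t n) < h - t k" "(\<Sum>n\<leftarrow>bs. t n) < h'"
      by blast
    then show ?thesis by (intro exI[of _ "k # as"]) auto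
  qed
qed simp

context group_filtration
begin

text \<open>Every second member is kept, so that three consecutive factors from one level multiply into the
  level above. Level \<open>0\<close> is the whole group, so that every element has some finite chain norm.\<close>

definition sparse_W :: "nat \<Rightarrow> 'a set" where
  "sparse_W n = (if n = 0 then carrier G else W (2 * n))"

primrec chain :: "nat list \<Rightarrow> 'a set" where
  "chain [] = {\<one>}"
| "chain (n # ns) = {a \<otimes> b | a b. a \<in> sparse_W n \<and> b \<in> chain ns}"

definition weight :: "nat list \<Rightarrow> real" where
  "weight ns = (\<Sum>n\<leftarrow>ns. (1/2) ^ n)"

lemma weight_nonneg: "weight ns \<ge> 0"
  by (induction ns) (auto simp: weight_def)

lemma sparse_W_closed: "x \<in> sparse_W n \<Longrightarrow> x \<in> carrier G"
  by (auto simp: sparse_W_def split: if_splits)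

lemma sparse_W_one: "\<one> \<in> sparse_W n"
  by (auto simp: sparse_W_def W_one)

lemma sparse_W_inv: "x \<in> sparse_W n \<Longrightarrow> inv x \<in> sparse_W n"
  by (auto simp: sparse_W_def W_inv split: if_splits)

lemma sparse_W_antimono: "m \<le> n \<Longrightarrow> sparse_W n \<subseteq> sparse_W m"
  using W_antimono[of "2 * m" "2 * n"] by (auto simp: sparse_W_def)

lemma sparse_W_mult3:
  assumes "x \<in> sparse_W (Suc n)" "y \<in> sparse_W (Suc n)" "z \<in> sparse_W (Suc n)"
  shows "x \<otimes> y \<otimes> z \<in> sparse_W n"
  using W_mult3[of x "2 * n" y z] assms by (auto simp: sparse_W_def)

lemma chain_closed: "x \<in> chain ns \<Longrightarrow> x \<in> carrier G"
  by (induction ns arbitrary: x) (auto dest: sparse_W_closed)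

lemma chain_append:
  "\<lbrakk>a \<in> chain ns; b \<in> chain ms\<rbrakk> \<Longrightarrow> a \<otimes> b \<in> chain (ns @ ms)"
proof (induction ns arbitrary: a)
  case Nil
  then show ?case by (simp add: chain_closed)
next
  case (Cons n ns)
  then obtain c d where cd: "a = c \<otimes> d" "c \<in> sparse_W n" "d \<in> chain ns" by auto
  then have "a \<otimes> b = c \<otimes> (d \<otimes> b)"
    using Cons.prems by (simp add: m_assoc sparse_W_closed chain_closed)
  then show ?case using cd Cons by auto
qed

lemma chain_append_split:
  "x \<in> chain (ns @ ms) \<Longrightarrow> \<exists>a\<in>chain ns. \<exists>b\<in>chain ms. x = a \<otimes> b"
proof (induction ns arbitrary: x)
  case Nil
  then show ?case by (auto simp: chain_closed)
next
  case (Cons n ns)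
  then obtain c d where cd: "x = c \<otimes> d" "c \<in> sparse_W n" "d \<in> chain (ns @ ms)" by auto
  with Cons.IH obtain a b where "a \<in> chain ns" "b \<in> chain ms" "d = a \<otimes> b" by blast
  with cd show ?case
    by (intro bexI[of _ "c \<otimes> a"] bexI[of _ b]) (auto simp: m_assoc sparse_W_closed chain_closed)
qed

lemma chain_inv: "x \<in> chain ns \<Longrightarrow> inv x \<in> chain (rev ns)"
proof (induction ns arbitrary: x)
  case (Cons n ns)
  then obtain c d where cd: "x = c \<otimes> d" "c \<in> sparse_W n" "d \<in> chain ns" by auto
  have "inv c \<in> chain [n]" using sparse_W_inv[OF cd(2)] sparse_W_closed by force
  then have "inv d \<otimes> inv c \<in> chain (rev ns @ [n])"
    using cd Cons.IH chain_append by blast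
  then show ?case using cd by (simp add: inv_mult_group sparse_W_closed chain_closed)
qed simp

text \<open>By induction on the length: a chain of weight below \<open>2\<^sup>-\<^sup>n\<close> is cut into two parts of weight below
  \<open>2\<^sup>-\<^sup>n\<^sup>-\<^sup>1\<close> and one step in between, each of which lies in level \<open>n + 1\<close>.\<close>

lemma chain_subset_sparse_W: "weight ns < (1/2) ^ n \<Longrightarrow> chain ns \<subseteq> sparse_W n"
proof (induction ns arbitrary: n rule: length_induct)
  case (1 ns)
  show ?case
  proof (cases "ns = []")
    case True
    then show ?thesis by (simp add: sparse_W_one)
  next
    case False
    have "(\<Sum>n\<leftarrow>ns. (1/2) ^ n) < (1/2) ^ Suc n + (1/2 :: real) ^ Suc n"
      using 1 by (simp add: weight_def)
    from halving_split[OF False this] obtain as k bs where split: "ns = as @ k # bs"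
      "weight as < (1/2) ^ Suc n" "weight bs < (1/2) ^ Suc n"
      by (auto simp: weight_def)
    have "(1/2 :: real) ^ k \<le> weight ns"
      using weight_nonneg[of as] weight_nonneg[of bs] by (simp add: split weight_def)
    then have "(1/2 :: real) ^ k < (1/2) ^ n" using "1.prems" by (rule order.strict_trans1)
    then have "k \<ge> Suc n" by simp
    then have sparse_W: "chain as \<subseteq> sparse_W (Suc n)" "sparse_W k \<subseteq> sparse_W (Suc n)" "chain bs \<subseteq> sparse_W (Suc n)"
      using 1 split sparse_W_antimono by (auto simp del: power_Suc)
    show ?thesis
    proof
      fix x assume "x \<in> chain ns"
      then obtain a b c where abc: "a \<in> chain as" "b \<in> sparse_W k" "c \<in> chain bs" "x = a \<otimes> (b \<otimes> c)"
        using chain_append_split[of x as "k # bs"] split by auto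
      then have "x = a \<otimes> b \<otimes> c" by (simp add: m_assoc sparse_W_closed chain_closed)
      then show "x \<in> sparse_W n" using abc sparse_W sparse_W_mult3 by blast
    qed
  qed
qed

text \<open>The group norm of Birkhoff and Kakutani; \<open>x, y \<mapsto> chain_norm (x\<^sup>-\<^sup>1 y)\<close> is a left-invariant
  pseudometric.\<close>

definition chain_norm :: "'a \<Rightarrow> real" where
  "chain_norm x = (INF ns\<in>{ns. x \<in> chain ns}. weight ns)"

lemma chain_single: "x \<in> sparse_W n \<Longrightarrow> x \<in> chain [n]"
  using sparse_W_closed by force

lemma chain_norm_le: "x \<in> chain ns \<Longrightarrow> chain_norm x \<le> weight ns"
  unfolding chain_norm_def
  by (intro cINF_lower bdd_belowI2[of _ 0]) (auto simp: weight_nonneg)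

lemma chain_norm_less:
  assumes "x \<in> carrier G" "chain_norm x < e"
  obtains ns where "x \<in> chain ns" "weight ns < e"
proof -
  have "x \<in> chain [0]" using assms by (intro chain_single) (simp add: sparse_W_def)
  then have "{ns. x \<in> chain ns} \<noteq> {}" by blast
  then have "\<exists>y\<in>weight ` {ns. x \<in> chain ns}. y < e"
    using cInf_lessD[of "weight ` {ns. x \<in> chain ns}" e] assms unfolding chain_norm_def by blast
  then show ?thesis using that by blast
qed

lemma chain_norm_nonneg: "x \<in> carrier G \<Longrightarrow> chain_norm x \<ge> 0"
  using chain_norm_less[of x 0] weight_nonneg by (force simp: not_le[symmetric])

lemma chain_norm_sparse_W: "x \<in> sparse_W n \<Longrightarrow> chain_norm x \<le> (1/2) ^ n"
  using chain_norm_le[OF chain_single] by (force simp: weight_def)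

lemma chain_norm_less_sparse_W: "\<lbrakk>x \<in> carrier G; chain_norm x < (1/2) ^ n\<rbrakk> \<Longrightarrow> x \<in> sparse_W n"
  using chain_norm_less chain_subset_sparse_W by blast

lemma chain_norm_inv: "x \<in> carrier G \<Longrightarrow> chain_norm (inv x) = chain_norm x"
proof -
  have "chain_norm (inv x) \<le> chain_norm x" if x: "x \<in> carrier G" for x
  proof (rule field_le_epsilon)
    fix e :: real assume "e > 0"
    then obtain ns where "x \<in> chain ns" "weight ns < chain_norm x + e"
      using chain_norm_less[OF x, of "chain_norm x + e"] by auto
    moreover have "weight (rev ns) = weight ns"
      by (simp add: weight_def rev_map[symmetric] sum_list_rev)
    ultimately show "chain_norm (inv x) \<le> chain_norm x + e"
      using chain_norm_le[OF chain_inv] by force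
  qed
  from this[of x] this[of "inv x"] show "x \<in> carrier G \<Longrightarrow> ?thesis" by force
qed

lemma chain_norm_mult:
  assumes "x \<in> carrier G" "y \<in> carrier G"
  shows "chain_norm (x \<otimes> y) \<le> chain_norm x + chain_norm y"
proof (rule field_le_epsilon)
  fix e :: real assume "e > 0"
  then have e: "chain_norm x < chain_norm x + e/2" "chain_norm y < chain_norm y + e/2" by auto
  obtain ns where ns: "x \<in> chain ns" "weight ns < chain_norm x + e/2"
    using chain_norm_less[OF assms(1) e(1)] .
  obtain ms where ms: "y \<in> chain ms" "weight ms < chain_norm y + e/2"
    using chain_norm_less[OF assms(2) e(2)] .
  have "chain_norm (x \<otimes> y) \<le> weight (ns @ ms)"
    by (rule chain_norm_le[OF chain_append[OF ns(1) ms(1)]])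
  then show "chain_norm (x \<otimes> y) \<le> chain_norm x + chain_norm y + e"
    using ns ms by (simp add: weight_def)
qed

text \<open>The Birkhoff--Kakutani theorem. By \<open>chain_norm_sparse_W\<close> and \<open>chain_norm_less_sparse_W\<close>, balls of
  the chain metric and translates of the \<open>W n\<close> refine each other; trivial intersection gives positivity.\<close>

theorem metrizable_filtration_topology:
  assumes sep: "(\<Inter>n. W n) = {\<one>}"
  shows "metrizable_space filtration_topology"
proof -
  define d where "d x y = (if x \<in> carrier G \<and> y \<in> carrier G then chain_norm (inv x \<otimes> y) else 0)" for x y
  interpret M: Metric_space "carrier G" d
  proof
    show "0 \<le> d x y" for x y by (auto simp: d_def chain_norm_nonneg)
    show "d x y = d y x" for x y
      using chain_norm_inv[of "inv x \<otimes> y"] by (cases "x \<in> carrier G \<and> y \<in> carrier G") (auto simp: d_def inv_mult_group)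
    show "d x y = 0 \<longleftrightarrow> x = y" if "x \<in> carrier G" "y \<in> carrier G" for x y
    proof
      assume "d x y = 0"
      then have "inv x \<otimes> y \<in> sparse_W (Suc n)" for n
        using that by (intro chain_norm_less_sparse_W) (auto simp: d_def)
      then have "inv x \<otimes> y \<in> W n" for n
        using W_antimono[of n "2 * Suc n"] by (force simp: sparse_W_def)
      then have "inv x \<otimes> y = \<one>" using sep by blast
      then show "x = y" using that by (metis inv_solve_left' r_one one_closed)
    next
      have "chain_norm \<one> \<le> weight []" by (rule chain_norm_le) simp
      then have "chain_norm \<one> = 0" using chain_norm_nonneg[of \<one>] by (simp add: weight_def)
      then show "x = y \<Longrightarrow> d x y = 0" using that by (simp add: d_def)
    qed
    show "d x z \<le> d x y + d y z" if "x \<in> carrier G" "y \<in> carrier G" "z \<in> carrier G" for x y z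
      using chain_norm_mult[of "inv x \<otimes> y" "inv y \<otimes> z"] that
      by (simp add: d_def group_normalize)
  qed
  have "openin M.mtopology U \<longleftrightarrow> openin filtration_topology U" for U
    unfolding M.openin_mtopology openin_filtration_topology
  proof (intro conj_cong refl iffI ballI allI impI)
    fix x assume U: "U \<subseteq> carrier G" and *: "\<forall>x. x \<in> U \<longrightarrow> (\<exists>r>0. M.mball x r \<subseteq> U)" and "x \<in> U"
    then obtain r where r: "r > 0" "M.mball x r \<subseteq> U" by blast
    obtain n where n: "(1/2 :: real) ^ n < r" using real_arch_pow_inv[of r "1/2"] r by auto
    have x: "x \<in> carrier G" using U \<open>x \<in> U\<close> by blast
    have "x \<otimes> w \<in> U" if w: "w \<in> W (2 * Suc n)" for w
    proof -
      have "chain_norm w \<le> (1/2) ^ Suc n" using w by (intro chain_norm_sparse_W) (simp add: sparse_W_def)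
      also have "\<dots> \<le> (1/2) ^ n" by simp
      finally have "d x (x \<otimes> w) < r" using x w n by (simp add: d_def inv_mult_cancel)
      then show ?thesis using r x w by auto
    qed
    then show "\<exists>n. \<forall>w\<in>W n. x \<otimes> w \<in> U" by blast
  next
    fix x assume U: "U \<subseteq> carrier G" and *: "\<forall>x\<in>U. \<exists>n. \<forall>w\<in>W n. x \<otimes> w \<in> U" and "x \<in> U"
    then obtain n where n: "\<forall>w\<in>W n. x \<otimes> w \<in> U" by blast
    have "y \<in> U" if "y \<in> M.mball x ((1/2) ^ Suc n)" for y
    proof -
      have xy: "x \<in> carrier G" "y \<in> carrier G" using that by auto
      have "inv x \<otimes> y \<in> sparse_W (Suc n)"
        using that xy by (intro chain_norm_less_sparse_W) (auto simp: d_def)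
      then have "inv x \<otimes> y \<in> W n" using W_antimono[of n "2 * Suc n"] by (force simp: sparse_W_def)
      then show ?thesis using n xy inv_mult_cancel(2) by metis
    qed
    then show "\<exists>r>0. M.mball x r \<subseteq> U" by (intro exI[of _ "(1/2) ^ Suc n"]) auto
  qed
  then have "filtration_topology = M.mtopology" by (simp add: topology_eq)
  then show ?thesis by (simp add: M.metrizable_space_mtopology)
qed

corollary topological_group_filtration_topology:
  assumes "(\<Inter>n. W n) = {\<one>}"
  shows "topological_group G filtration_topology"
  unfolding topological_group_def
  using metrizable_filtration_topology[OF assms] continuous_map_filtration_mult
    continuous_map_filtration_inv metrizable_imp_Hausdorff_space by auto

end

section \<open>Quotients and completions of filtered groups\<close>

context group_filtration
begin

text \<open>The closure of the identity in the filtration topology, hence the kernel of the map to its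
  Hausdorff quotient.\<close>

definition core :: "'a set" where
  "core = (\<Inter>n. W n)"

lemma core_normal: "core \<lhd> G"
  unfolding normal_inv_iff
proof (intro conjI ballI subgroupI)
  show "core \<subseteq> carrier G" by (auto simp: core_def)
  show "core \<noteq> {}" using W_one by (auto simp: core_def)
  show "inv x \<in> core" if "x \<in> core" for x using that W_inv by (auto simp: core_def)
  show "x \<otimes> y \<in> core" if "x \<in> core" "y \<in> core" for x y
    using that W_mult by (simp add: core_def)
  show "x \<otimes> h \<otimes> inv x \<in> core" if "x \<in> carrier G" "h \<in> core" for x h
    using W_conj[OF that(1)] that(2) by (force simp: core_def)
qed

text \<open>The Hausdorff quotient. It is applied twice: to \<open>G\<close> itself, and to the group of Cauchy sequences,
  where it gives the completion.\<close>

lemma quotient_filtration: "group_filtration (G Mod core) (\<lambda>n. (\<lambda>w. core #> w) ` W n)"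
proof -
  interpret N: normal core G by (rule core_normal)
  show ?thesis
  proof (intro group_filtration.intro group_filtration_axioms.intro)
    show "Group.group (G Mod core)" by (rule N.factorgroup_is_group)
    show "(\<lambda>w. core #> w) ` W n \<subseteq> carrier (G Mod core)" for n
      by (auto simp: carrier_FactGroup)
    show "\<one>\<^bsub>G Mod core\<^esub> \<in> (\<lambda>w. core #> w) ` W n" for n
      using W_one coset_mult_one[OF N.subset] by (auto intro!: image_eqI[of _ _ \<one>])
    show "inv\<^bsub>G Mod core\<^esub> A \<in> (\<lambda>w. core #> w) ` W n" if "A \<in> (\<lambda>w. core #> w) ` W n" for A n
    proof -
      from that obtain w where w: "w \<in> W n" "A = core #> w" by blast
      then have "inv\<^bsub>G Mod core\<^esub> A = core #> inv w"
        by (subst N.inv_FactGroup) (auto simp: carrier_FactGroup N.rcos_inv)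
      then show ?thesis using W_inv[OF w(1)] by blast
    qed
    show "A \<otimes>\<^bsub>G Mod core\<^esub> Y \<in> (\<lambda>w. core #> w) ` W n"
      if "A \<in> (\<lambda>w. core #> w) ` W (Suc n)" "Y \<in> (\<lambda>w. core #> w) ` W (Suc n)" for A Y n
      using that W_mult by (auto simp: N.rcos_sum)
    show "\<exists>m. \<forall>A\<in>(\<lambda>w. core #> w) ` W m.
        g \<otimes>\<^bsub>G Mod core\<^esub> A \<otimes>\<^bsub>G Mod core\<^esub> inv\<^bsub>G Mod core\<^esub> g \<in> (\<lambda>w. core #> w) ` W n"
      if "g \<in> carrier (G Mod core)" for g n
    proof -
      from that obtain x where x: "x \<in> carrier G" "g = core #> x"
        by (auto simp: carrier_FactGroup)
      then have "inv\<^bsub>G Mod core\<^esub> g = core #> inv x"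
        by (subst N.inv_FactGroup) (auto simp: carrier_FactGroup N.rcos_inv)
      moreover obtain m where "\<forall>w\<in>W m. x \<otimes> w \<otimes> inv x \<in> W n" using W_conj x(1) by blast
      ultimately show ?thesis using x by (intro exI[of _ m]) (auto simp: N.rcos_sum)
    qed
  qed
qed

lemma coset_core_in_W_imp:
  assumes x: "x \<in> carrier G" and "core #> x \<in> (\<lambda>w. core #> w) ` W (Suc n)"
  shows "x \<in> W n"
proof -
  interpret N: normal core G by (rule core_normal)
  obtain w where w: "w \<in> W (Suc n)" "core #> x = core #> w" using assms(2) by blast
  then have "x \<in> core #> w" using rcos_self[OF x N.subgroup_axioms] by simp
  then obtain h where "h \<in> core" "x = h \<otimes> w" by (auto simp: r_coset_def)
  then show ?thesis using w W_mult by (auto simp: core_def)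
qed

lemma Inter_quotient_filtration: "(\<Inter>n. (\<lambda>w. core #> w) ` W n) = {\<one>\<^bsub>G Mod core\<^esub>}"
proof -
  interpret N: normal core G by (rule core_normal)
  interpret Q: group_filtration "G Mod core" "\<lambda>n. (\<lambda>w. core #> w) ` W n"
    by (rule quotient_filtration)
  show ?thesis
  proof (intro equalityI subsetI)
    fix A assume A: "A \<in> (\<Inter>n. (\<lambda>w. core #> w) ` W n)"
    then have "A \<in> (\<lambda>w. core #> w) ` W 0" by blast
    then obtain x where x: "x \<in> carrier G" "A = core #> x"
      using W_closed by blast
    have "x \<in> W n" for n
      using A x by (intro coset_core_in_W_imp) blast+
    then have "x \<in> core" by (simp add: core_def)
    then show "A \<in> {\<one>\<^bsub>G Mod core\<^esub>}" using x by (simp add: N.rcos_const)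
  qed (use Q.W_one in auto)
qed

text \<open>Cauchy for the two-sided uniformity. The inverse of a one-sided Cauchy sequence need not be
  one-sided Cauchy, so these would not form a group.\<close>

definition Cauchy_seq :: "(nat \<Rightarrow> 'a) \<Rightarrow> bool" where
  "Cauchy_seq x \<longleftrightarrow> range x \<subseteq> carrier G \<and>
     (\<forall>n. \<exists>M. \<forall>j\<ge>M. \<forall>k\<ge>M. inv (x j) \<otimes> x k \<in> W n \<and> x j \<otimes> inv (x k) \<in> W n)"

lemma Cauchy_seq_closed: "Cauchy_seq x \<Longrightarrow> x n \<in> carrier G"
  by (auto simp: Cauchy_seq_def)

lemma Cauchy_seqD:
  "Cauchy_seq x \<Longrightarrow> \<exists>M. \<forall>j\<ge>M. \<forall>k\<ge>M. inv (x j) \<otimes> x k \<in> W n \<and> x j \<otimes> inv (x k) \<in> W n"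
  unfolding Cauchy_seq_def by blast

lemma Cauchy_seq_const: "g \<in> carrier G \<Longrightarrow> Cauchy_seq (\<lambda>_. g)"
  by (auto simp: Cauchy_seq_def W_one)

lemma Cauchy_seq_inv: "Cauchy_seq x \<Longrightarrow> Cauchy_seq (\<lambda>k. inv (x k))"
  unfolding Cauchy_seq_def
proof (elim conjE, intro conjI allI)
  fix n
  assume x: "range x \<subseteq> carrier G"
    and "\<forall>n. \<exists>M. \<forall>j\<ge>M. \<forall>k\<ge>M. inv (x j) \<otimes> x k \<in> W n \<and> x j \<otimes> inv (x k) \<in> W n"
  then obtain M where "\<forall>j\<ge>M. \<forall>k\<ge>M. inv (x j) \<otimes> x k \<in> W n \<and> x j \<otimes> inv (x k) \<in> W n"
    by blast
  moreover have "inv (inv (x k)) = x k" for k using x by (intro inv_inv) blast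
  ultimately show "\<exists>M. \<forall>j\<ge>M. \<forall>k\<ge>M. inv (inv (x j)) \<otimes> inv (x k) \<in> W n \<and>
      inv (x j) \<otimes> inv (inv (x k)) \<in> W n"
    by (intro exI[of _ M]) simp
qed auto

text \<open>One exponent \<open>m\<close> serves all late terms: with \<open>u = x\<^sub>k x\<^sub>M\<^sup>-\<^sup>1\<close> small, conjugation by \<open>x\<^sub>k = u x\<^sub>M\<close> is
  conjugation by the fixed element \<open>x\<^sub>M\<close> followed by conjugation by the small element \<open>u\<close>. This
  uniformity is what makes the Cauchy sequences a group on which the conjugation axiom holds.\<close>

lemma Cauchy_seq_conj:
  assumes "Cauchy_seq x"
  shows "\<exists>m M. \<forall>k\<ge>M. \<forall>w\<in>W m. x k \<otimes> w \<otimes> inv (x k) \<in> W n"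
proof -
  note [simp] = Cauchy_seq_closed[OF assms]
  obtain M where M: "\<And>j k. \<lbrakk>j \<ge> M; k \<ge> M\<rbrakk> \<Longrightarrow> x j \<otimes> inv (x k) \<in> W (n + 2)"
    using Cauchy_seqD[OF assms, of "n + 2"] by auto
  obtain m where m: "\<And>w. w \<in> W m \<Longrightarrow> x M \<otimes> w \<otimes> inv (x M) \<in> W (n + 2)"
    using W_conj_ge[of "x M" 0] by auto
  show ?thesis
  proof (intro exI allI impI ballI)
    fix k w assume k: "k \<ge> M" and w: "w \<in> W m"
    have "(x k \<otimes> inv (x M)) \<otimes> (x M \<otimes> w \<otimes> inv (x M)) \<otimes> (x M \<otimes> inv (x k)) \<in> W n"
      by (intro W_mult3 M m w k order_refl)
    then show "x k \<otimes> w \<otimes> inv (x k) \<in> W n"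
      using w by (simp add: group_normalize)
  qed
qed

lemma Cauchy_seq_mult:
  assumes x: "Cauchy_seq x" and y: "Cauchy_seq y"
  shows "Cauchy_seq (\<lambda>k. x k \<otimes> y k)"
  unfolding Cauchy_seq_def
proof (intro conjI allI)
  note [simp] = Cauchy_seq_closed[OF x] Cauchy_seq_closed[OF y]
  show "range (\<lambda>k. x k \<otimes> y k) \<subseteq> carrier G" by auto
  fix n
  obtain m1 M1 where 1: "\<And>k w. \<lbrakk>k \<ge> M1; w \<in> W m1\<rbrakk> \<Longrightarrow> x k \<otimes> w \<otimes> inv (x k) \<in> W (Suc n)"
    using Cauchy_seq_conj[OF x, of "Suc n"] by metis
  obtain m2 M2 where 2: "\<And>k w. \<lbrakk>k \<ge> M2; w \<in> W m2\<rbrakk> \<Longrightarrow> inv (y k) \<otimes> w \<otimes> y k \<in> W (Suc n)"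
    using Cauchy_seq_conj[OF Cauchy_seq_inv[OF y], of "Suc n"] by (simp, metis)
  define m where "m = Suc n + m1 + m2"
  obtain M3 where 3: "\<And>j k. \<lbrakk>j \<ge> M3; k \<ge> M3\<rbrakk> \<Longrightarrow> inv (x j) \<otimes> x k \<in> W m"
    "\<And>j k. \<lbrakk>j \<ge> M3; k \<ge> M3\<rbrakk> \<Longrightarrow> x j \<otimes> inv (x k) \<in> W m"
    using Cauchy_seqD[OF x, of m] by auto
  obtain M4 where 4: "\<And>j k. \<lbrakk>j \<ge> M4; k \<ge> M4\<rbrakk> \<Longrightarrow> inv (y j) \<otimes> y k \<in> W m"
    "\<And>j k. \<lbrakk>j \<ge> M4; k \<ge> M4\<rbrakk> \<Longrightarrow> y j \<otimes> inv (y k) \<in> W m"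
    using Cauchy_seqD[OF y, of m] by auto
  define M where "M = M1 + M2 + M3 + M4"
  show "\<exists>M. \<forall>j\<ge>M. \<forall>k\<ge>M. inv (x j \<otimes> y j) \<otimes> (x k \<otimes> y k) \<in> W n \<and>
      x j \<otimes> y j \<otimes> inv (x k \<otimes> y k) \<in> W n"
  proof (intro exI[of _ M] allI impI conjI)
    fix j k assume jk: "j \<ge> M" "k \<ge> M"
    then have ge: "j \<ge> M1" "j \<ge> M2" "j \<ge> M3" "j \<ge> M4" "k \<ge> M3" "k \<ge> M4" by (auto simp: M_def)
    have "(inv (y j) \<otimes> (inv (x j) \<otimes> x k) \<otimes> y j) \<otimes> (inv (y j) \<otimes> y k) \<in> W n"
      by (intro W_mult[of _ n] 2 ge W_mono[OF 3(1), of _ _ m2] W_mono[OF 4(1), of _ _ "Suc n"])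
        (auto simp: m_def)
    then show "inv (x j \<otimes> y j) \<otimes> (x k \<otimes> y k) \<in> W n" by (simp add: group_normalize)
    have "(x j \<otimes> (y j \<otimes> inv (y k)) \<otimes> inv (x j)) \<otimes> (x j \<otimes> inv (x k)) \<in> W n"
      by (intro W_mult[of _ n] 1 ge W_mono[OF 4(2), of _ _ m1] W_mono[OF 3(2), of _ _ "Suc n"])
        (auto simp: m_def)
    then show "x j \<otimes> y j \<otimes> inv (x k \<otimes> y k) \<in> W n" by (simp add: group_normalize)
  qed
qed

definition Cauchy_group :: "(nat \<Rightarrow> 'a) monoid" where
  "Cauchy_group = \<lparr>carrier = {x. Cauchy_seq x}, monoid.mult = (\<lambda>x y k. x k \<otimes> y k), one = (\<lambda>_. \<one>)\<rparr>"

lemma group_Cauchy_group: "Group.group Cauchy_group"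
  unfolding Cauchy_group_def
proof (rule groupI; simp)
  show "\<exists>y. Cauchy_seq y \<and> (\<lambda>k. y k \<otimes> x k) = (\<lambda>_. \<one>)" if "Cauchy_seq x" for x
    using that by (intro exI[of _ "\<lambda>k. inv (x k)"]) (auto simp: Cauchy_seq_inv Cauchy_seq_closed)
qed (auto simp: Cauchy_seq_mult Cauchy_seq_const Cauchy_seq_closed m_assoc)

lemma inv_Cauchy_group: "Cauchy_seq x \<Longrightarrow> inv\<^bsub>Cauchy_group\<^esub> x = (\<lambda>k. inv (x k))"
  by (rule group.inv_equality[OF group_Cauchy_group])
    (auto simp: Cauchy_group_def Cauchy_seq_inv Cauchy_seq_closed)

text \<open>Its core consists of the null sequences, and the quotient of \<open>Cauchy_group\<close> by this core is the
  Raikov completion of the Hausdorff quotient of \<open>G\<close> in the filtration topology.\<close>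

definition Cauchy_filtration :: "nat \<Rightarrow> (nat \<Rightarrow> 'a) set" where
  "Cauchy_filtration n = {x. Cauchy_seq x \<and> (\<forall>\<^sub>F k in sequentially. x k \<in> W n)}"

lemma group_filtration_Cauchy: "group_filtration Cauchy_group Cauchy_filtration"
proof (intro group_filtration.intro group_filtration_axioms.intro group_Cauchy_group)
  show "Cauchy_filtration n \<subseteq> carrier Cauchy_group" "\<one>\<^bsub>Cauchy_group\<^esub> \<in> Cauchy_filtration n" for n
    by (auto simp: Cauchy_filtration_def Cauchy_group_def Cauchy_seq_const W_one)
  show "inv\<^bsub>Cauchy_group\<^esub> x \<in> Cauchy_filtration n" if "x \<in> Cauchy_filtration n" for x n
    using that
    by (auto simp: Cauchy_filtration_def inv_Cauchy_group Cauchy_seq_inv W_inv elim: eventually_mono)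
  show "x \<otimes>\<^bsub>Cauchy_group\<^esub> y \<in> Cauchy_filtration n"
    if "x \<in> Cauchy_filtration (Suc n)" "y \<in> Cauchy_filtration (Suc n)" for x y n
    using that
    by (auto simp: Cauchy_filtration_def Cauchy_group_def Cauchy_seq_mult W_mult elim: eventually_elim2)
  show "\<exists>m. \<forall>w\<in>Cauchy_filtration m.
      x \<otimes>\<^bsub>Cauchy_group\<^esub> w \<otimes>\<^bsub>Cauchy_group\<^esub> inv\<^bsub>Cauchy_group\<^esub> x \<in> Cauchy_filtration n"
    if "x \<in> carrier Cauchy_group" for x n
  proof -
    have x: "Cauchy_seq x" using that by (simp add: Cauchy_group_def)
    obtain m M where mM: "\<And>k w. \<lbrakk>k \<ge> M; w \<in> W m\<rbrakk> \<Longrightarrow> x k \<otimes> w \<otimes> inv (x k) \<in> W n"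
      using Cauchy_seq_conj[OF x, of n] by metis
    have "(\<lambda>k. x k \<otimes> w k \<otimes> inv (x k)) \<in> Cauchy_filtration n" if w: "w \<in> Cauchy_filtration m" for w
    proof -
      have "\<forall>\<^sub>F k in sequentially. x k \<otimes> w k \<otimes> inv (x k) \<in> W n"
        using eventually_conj[OF _ eventually_ge_at_top[of M]] w mM
        by (force simp: Cauchy_filtration_def elim: eventually_mono)
      then show ?thesis
        using w x by (simp add: Cauchy_filtration_def Cauchy_seq_mult Cauchy_seq_inv)
    qed
    then show ?thesis
      using x by (intro exI[of _ m]) (auto simp: inv_Cauchy_group, simp add: Cauchy_group_def)
  qed
qed

end

section \<open>Filtrations by neighbourhoods in a topological group\<close>

locale nbhd_filtration = group_filtration +
  fixes T :: "'a topology"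
  assumes topological_group: "topological_group G T"
    and W_nbhd: "neighbourhood T \<one> (W n)"

lemma openin_left_translate:
  fixes G (structure)
  assumes G: "topological_group G T" and O: "openin T O'" and x: "x \<in> carrier G"
  shows "openin T {y \<in> carrier G. x \<otimes> y \<in> O'}"
proof -
  have top: "topspace T = carrier G"
    and cont: "continuous_map (prod_topology T T) T (\<lambda>(x, y). x \<otimes> y)"
    using G by (auto simp: topological_group_def)
  have "continuous_map T (prod_topology T T) (\<lambda>y. (x, y))"
    using x top by (auto simp: continuous_map_pairwise o_def)
  from continuous_map_compose[OF this cont] have "continuous_map T T (\<lambda>y. x \<otimes> y)"
    by (simp add: o_def)
  from openin_continuous_map_preimage[OF this O] show ?thesis by (simp add: top)
qed

lemma topological_group_subgroup:
  assumes G: "topological_group G T" and S: "subgroup S G"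
  shows "topological_group (G\<lparr>carrier := S\<rparr>) (subtopology T S)"
proof -
  interpret G: Group.group G using G by (simp add: topological_group_def)
  interpret S: subgroup S G by (rule S)
  have top: "topspace T = carrier G" and T2: "Hausdorff_space T"
    and m: "continuous_map (prod_topology T T) T (\<lambda>(x, y). x \<otimes>\<^bsub>G\<^esub> y)"
    and i: "continuous_map T T (\<lambda>x. inv\<^bsub>G\<^esub> x)"
    using G by (auto simp: topological_group_def)
  have tS: "topspace (subtopology T S) = S" using S.subset top by auto
  have "continuous_map (subtopology T S) (subtopology T S) (\<lambda>x. inv\<^bsub>G\<^esub> x)"
    using continuous_map_from_subtopology[OF i] tS by (auto simp: continuous_map_in_subtopology)
  then have i': "continuous_map (subtopology T S) (subtopology T S) (\<lambda>x. inv\<^bsub>G\<lparr>carrier := S\<rparr>\<^esub> x)"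
    by (rule continuous_map_eq) (simp add: tS G.m_inv_consistent[OF S])
  have "prod_topology (subtopology T S) (subtopology T S) = subtopology (prod_topology T T) (S \<times> S)"
    by (simp add: subtopology_Times)
  then have "continuous_map (prod_topology (subtopology T S) (subtopology T S)) (subtopology T S)
      (\<lambda>(x, y). x \<otimes>\<^bsub>G\<^esub> y)"
    using continuous_map_from_subtopology[OF m] by (auto simp: continuous_map_in_subtopology)
  then show ?thesis
    unfolding topological_group_def
    using i' tS T2 G.subgroup_imp_group[OF S] by (simp add: Hausdorff_space_subtopology)
qed

context nbhd_filtration
begin

lemma topspace_T: "topspace T = carrier G"
  using topological_group by (simp add: topological_group_def)

text \<open>The filtration topology is coarser than \<open>T\<close>, because each translate of each \<open>W n\<close> is a
  \<open>T\<close>-neighbourhood.\<close>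

lemma openin_filtration_imp_openin:
  assumes "openin filtration_topology A"
  shows "openin T A"
proof (subst openin_subopen, intro ballI)
  fix x assume x: "x \<in> A"
  have xG: "x \<in> carrier G" using assms x openin_subset by fastforce
  obtain n where n: "\<forall>w\<in>W n. x \<otimes> w \<in> A" using assms x by (auto simp: openin_filtration_topology)
  obtain O' where O': "openin T O'" "\<one> \<in> O'" "O' \<subseteq> W n"
    using W_nbhd[of n] by (auto simp: neighbourhood_def)
  let ?B = "{y \<in> carrier G. inv x \<otimes> y \<in> O'}"
  have "openin T ?B"
    using openin_left_translate[OF topological_group O'(1)] xG by simp
  moreover have "x \<in> ?B" using xG O' by simp
  moreover have "?B \<subseteq> A"
  proof
    fix y assume "y \<in> ?B"
    then have "x \<otimes> (inv x \<otimes> y) \<in> A" "y \<in> carrier G" using n O' by auto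
    then show "y \<in> A" using xG by (simp add: inv_mult_cancel)
  qed
  ultimately show "\<exists>B. openin T B \<and> x \<in> B \<and> B \<subseteq> A" by blast
qed

text \<open>An \<open>h\<close>-complete subgroup has closed image in the completion. The class of a Cauchy sequence
  in the subgroup is a limit of the classes of its terms, hence is itself the class of a constant
  sequence, and that constant is a limit.\<close>

lemma h_complete_imp_Cauchy_convergent:
  assumes S: "subgroup S G"
    and hc: "h_complete (G\<lparr>carrier := S\<rparr>) (subtopology T S)"
    and x: "Cauchy_seq x" "range x \<subseteq> S"
  obtains s where "s \<in> S" "\<And>n. \<forall>\<^sub>F k in sequentially. inv (x k) \<otimes> s \<in> W n"
proof -
  interpret S: subgroup S G by (rule S)
  interpret C: group_filtration Cauchy_group Cauchy_filtration by (rule group_filtration_Cauchy)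
  let ?K = "C.core"
  interpret K: normal ?K Cauchy_group by (rule C.core_normal)
  let ?L = "Cauchy_group Mod ?K"
  let ?coset = "\<lambda>c. ?K #>\<^bsub>Cauchy_group\<^esub> c"
  interpret L: group_filtration ?L "\<lambda>n. ?coset ` Cauchy_filtration n" by (rule C.quotient_filtration)
  have Ltop: "topological_group ?L L.filtration_topology"
    by (rule L.topological_group_filtration_topology[OF C.Inter_quotient_filtration])
  define \<phi> where "\<phi> g = ?coset (\<lambda>_. g)" for g
  have const: "(\<lambda>_. g) \<in> carrier Cauchy_group" if "g \<in> carrier G" for g
    using that by (simp add: Cauchy_group_def Cauchy_seq_const)
  have \<phi>_mult: "\<phi> (g \<otimes> h) = \<phi> g \<otimes>\<^bsub>?L\<^esub> \<phi> h" if "g \<in> carrier G" "h \<in> carrier G" for g h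
    using that K.rcos_sum[OF const const] by (simp add: \<phi>_def) (simp add: Cauchy_group_def)
  have \<phi>_carrier: "\<phi> g \<in> carrier ?L" if "g \<in> carrier G" for g
    using that const by (auto simp: \<phi>_def carrier_FactGroup)
  have \<phi>_cont: "continuous_map T L.filtration_topology \<phi>"
    unfolding continuous_map_def
  proof (intro conjI allI impI)
    show "\<phi> \<in> topspace T \<rightarrow> topspace L.filtration_topology"
      by (auto simp: topspace_T \<phi>_carrier)
    fix U assume U: "openin L.filtration_topology U"
    have "openin filtration_topology {g \<in> topspace T. \<phi> g \<in> U}"
      unfolding openin_filtration_topology
    proof (intro conjI ballI)
      fix g assume "g \<in> {g \<in> topspace T. \<phi> g \<in> U}"
      then have g: "g \<in> carrier G" "\<phi> g \<in> U" by (auto simp: topspace_T)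
      then obtain n where n: "\<forall>A\<in>?coset ` Cauchy_filtration n. \<phi> g \<otimes>\<^bsub>?L\<^esub> A \<in> U"
        using U unfolding L.openin_filtration_topology by blast
      have "\<phi> (g \<otimes> w) \<in> U" if w: "w \<in> W n" for w
      proof -
        have "(\<lambda>_. w) \<in> Cauchy_filtration n"
          using w by (simp add: Cauchy_filtration_def Cauchy_seq_const)
        then have "\<phi> g \<otimes>\<^bsub>?L\<^esub> \<phi> w \<in> U" using n unfolding \<phi>_def by blast
        then show ?thesis using \<phi>_mult g w by simp
      qed
      then show "\<exists>n. \<forall>w\<in>W n. g \<otimes> w \<in> {g \<in> topspace T. \<phi> g \<in> U}"
        using g by (auto simp: topspace_T)
    qed (auto simp: topspace_T)
    then show "openin T {g \<in> topspace T. \<phi> g \<in> U}" by (rule openin_filtration_imp_openin)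
  qed
  have TS: "topological_group (G\<lparr>carrier := S\<rparr>) (subtopology T S)"
    by (rule topological_group_subgroup[OF topological_group S])
  have "closedin L.filtration_topology (\<phi> ` carrier (G\<lparr>carrier := S\<rparr>))"
  proof (rule h_complete_imp_closedin[OF TS hc Ltop])
    show "\<phi> \<in> hom (G\<lparr>carrier := S\<rparr>) ?L"
      by (rule homI) (use \<phi>_mult \<phi>_carrier S.mem_carrier in auto)
    show "continuous_map (subtopology T S) L.filtration_topology \<phi>"
      by (rule continuous_map_from_subtopology[OF \<phi>_cont])
  qed
  then have op: "openin L.filtration_topology (carrier ?L - \<phi> ` S)"
    by (simp add: closedin_def)
  have xC: "x \<in> carrier Cauchy_group" using x by (simp add: Cauchy_group_def)
  have xG: "x k \<in> carrier G" for k using Cauchy_seq_closed x by blast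
  have "?coset x \<in> \<phi> ` S"
  proof (rule ccontr)
    assume "?coset x \<notin> \<phi> ` S"
    then have "?coset x \<in> carrier ?L - \<phi> ` S" using xC by (auto simp: carrier_FactGroup)
    then obtain n where n: "\<forall>A\<in>?coset ` Cauchy_filtration n. ?coset x \<otimes>\<^bsub>?L\<^esub> A \<in> carrier ?L - \<phi> ` S"
      using op unfolding L.openin_filtration_topology by blast
    obtain M where M: "\<And>j k. \<lbrakk>j \<ge> M; k \<ge> M\<rbrakk> \<Longrightarrow> inv (x j) \<otimes> x k \<in> W n"
      using Cauchy_seqD[OF x(1), of n] by auto
    \<comment> \<open>The class of \<open>w\<close> is small and carries the class of \<open>x\<close> to that of the constant \<open>x M\<close>.\<close>
    define w where "w = (\<lambda>j. inv (x j) \<otimes> x M)"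
    have "w \<in> Cauchy_filtration n"
      using M x(1) xG unfolding Cauchy_filtration_def w_def
      by (auto intro!: Cauchy_seq_mult Cauchy_seq_inv Cauchy_seq_const eventually_sequentiallyI[of M])
    then have w: "w \<in> carrier Cauchy_group" "?coset x \<otimes>\<^bsub>?L\<^esub> ?coset w \<notin> \<phi> ` S"
      using n by (auto simp: Cauchy_group_def Cauchy_filtration_def)
    have "x \<otimes>\<^bsub>Cauchy_group\<^esub> w = (\<lambda>_. x M)"
      using xG by (simp add: Cauchy_group_def w_def inv_mult_cancel)
    then have "?coset x \<otimes>\<^bsub>?L\<^esub> ?coset w = \<phi> (x M)"
      using K.rcos_sum[OF xC w(1)] by (simp add: \<phi>_def)
    then show False using w(2) x(2) by (simp add: image_subset_iff)
  qed
  then obtain s where s: "s \<in> S" "?coset x = ?coset (\<lambda>_. s)" by (auto simp: \<phi>_def)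
  have sG: "s \<in> carrier G" using s by (rule_tac S.mem_carrier)
  have "x \<in> ?coset (\<lambda>_. s)"
    using C.rcos_self[OF xC K.subgroup_axioms] s(2) by simp
  then obtain h where h: "h \<in> ?K" "x = (\<lambda>k. h k \<otimes> s)" by (auto simp: r_coset_def Cauchy_group_def)
  have "\<forall>\<^sub>F k in sequentially. inv (x k) \<otimes> s \<in> W n" for n
  proof -
    obtain m where m: "\<And>w. w \<in> W m \<Longrightarrow> inv s \<otimes> w \<otimes> s \<in> W n"
      using W_conj_inv_ge[OF sG, of 0] by blast
    have "\<forall>\<^sub>F k in sequentially. h k \<in> W m"
      using h(1) by (auto simp: C.core_def Cauchy_filtration_def)
    then show ?thesis
    proof eventually_elim
      case (elim k)
      then show ?case using m[OF W_inv[OF elim]] h(2) sG by (simp add: inv_mult_group)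
    qed
  qed
  with s(1) show ?thesis by (rule that)
qed

end

section \<open>Filtrations from a quasi-invariant basis\<close>

lemma neighbourhood_Int:
  "\<lbrakk>neighbourhood T x A; neighbourhood T x B\<rbrakk> \<Longrightarrow> neighbourhood T x (A \<inter> B)"
  unfolding neighbourhood_def by (metis Int_iff Int_mono le_infI1 openin_Int)

lemma neighbourhood_mem: "neighbourhood T x A \<Longrightarrow> x \<in> A"
  by (auto simp: neighbourhood_def)

lemma neighbourhood_symmetric_root:
  fixes G (structure)
  assumes G: "topological_group G T" and A: "neighbourhood T \<one> A"
  obtains B where "neighbourhood T \<one> B" "\<And>x. x \<in> B \<Longrightarrow> inv x \<in> B"
    "\<And>x y. \<lbrakk>x \<in> B; y \<in> B\<rbrakk> \<Longrightarrow> x \<otimes> y \<in> A"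
proof -
  interpret Group.group G using G by (simp add: topological_group_def)
  have top: "topspace T = carrier G"
    and m: "continuous_map (prod_topology T T) T (\<lambda>(x, y). x \<otimes> y)"
    and i: "continuous_map T T (\<lambda>x. inv x)"
    using G by (auto simp: topological_group_def)
  obtain O' where O': "openin T O'" "\<one> \<in> O'" "O' \<subseteq> A"
    using A by (auto simp: neighbourhood_def)
  have "openin (prod_topology T T) {p \<in> topspace (prod_topology T T). (case p of (x, y) \<Rightarrow> x \<otimes> y) \<in> O'}"
    by (rule openin_continuous_map_preimage[OF m O'(1)])
  moreover have "(\<one>, \<one>) \<in> {p \<in> topspace (prod_topology T T). (case p of (x, y) \<Rightarrow> x \<otimes> y) \<in> O'}"
    using O' by (simp add: top)
  ultimately obtain P Q where PQ: "openin T P" "openin T Q" "\<one> \<in> P" "\<one> \<in> Q"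
    "P \<times> Q \<subseteq> {p \<in> topspace (prod_topology T T). (case p of (x, y) \<Rightarrow> x \<otimes> y) \<in> O'}"
    unfolding openin_prod_topology_alt by meson
  define R where "R = P \<inter> Q"
  have R: "openin T R" "\<one> \<in> R" "R \<subseteq> carrier G" using PQ openin_subset top by (auto simp: R_def)
  define B where "B = R \<inter> {x \<in> topspace T. inv x \<in> R}"
  have "openin T B"
    unfolding B_def using R openin_continuous_map_preimage[OF i R(1)] by blast
  then have "neighbourhood T \<one> B"
    using R top by (auto simp: neighbourhood_def B_def)
  moreover have "inv x \<in> B" if "x \<in> B" for x
    using that R top by (auto simp: B_def)
  moreover have "x \<otimes> y \<in> A" if "x \<in> B" "y \<in> B" for x y
    using that PQ(5) O'(3) by (auto simp: B_def R_def)
  ultimately show ?thesis using that by blast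
qed

text \<open>Intersecting initial segments of the countable family makes it decreasing, so that later
  constructions can take care of countably many families by a diagonal choice.\<close>

lemma quasi_invariant_decreasing_sequence:
  fixes G (structure)
  assumes qib: "quasi_invariant_basis G T" and ne: "carrier G \<noteq> {}"
    and A: "neighbourhood T \<one> A"
  obtains Q where "\<And>k. neighbourhood T \<one> (Q k)" "decseq Q"
    "\<And>g. g \<in> carrier G \<Longrightarrow> \<exists>k. \<forall>v\<in>Q k. g \<otimes> v \<otimes> inv g \<in> A"
proof -
  obtain \<V> where \<V>: "countable \<V>" "\<forall>V\<in>\<V>. neighbourhood T \<one> V"
    "\<forall>g\<in>carrier G. \<exists>V\<in>\<V>. {g \<otimes> v \<otimes> inv g | v. v \<in> V} \<subseteq> A"
    using qib[unfolded quasi_invariant_basis_def, rule_format, OF A]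
    by (elim exE conjE) (rule that; assumption)
  have "\<V> \<noteq> {}" using \<V>(3) ne by blast
  define Q where "Q k = (\<Inter>i\<le>k. from_nat_into \<V> i)" for k
  have "neighbourhood T \<one> (Q k)" for k
  proof (induction k)
    case 0
    then show ?case using \<V>(2) from_nat_into[OF \<open>\<V> \<noteq> {}\<close>] by (simp add: Q_def)
  next
    case (Suc k)
    have "Q (Suc k) = from_nat_into \<V> (Suc k) \<inter> Q k" by (simp add: Q_def atMost_Suc)
    then show ?case using Suc \<V>(2) from_nat_into[OF \<open>\<V> \<noteq> {}\<close>] by (metis neighbourhood_Int)
  qed
  moreover have "decseq Q" by (auto simp: Q_def decseq_def)
  moreover have "\<exists>k. \<forall>v\<in>Q k. g \<otimes> v \<otimes> inv g \<in> A" if g: "g \<in> carrier G" for g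
  proof -
    obtain V where V: "V \<in> \<V>" "{g \<otimes> v \<otimes> inv g | v. v \<in> V} \<subseteq> A"
      using \<V>(3)[rule_format, OF g] by (elim bexE)
    then obtain k where "from_nat_into \<V> k = V" using from_nat_into_surj[OF \<V>(1)] by blast
    then have "Q k \<subseteq> V" by (auto simp: Q_def)
    then show ?thesis using V(2) by blast
  qed
  ultimately show ?thesis using that by blast
qed

text \<open>Katz's observation: a quasi-invariant basis yields enough maps to metrizable groups. Each \<open>W n\<close>
  comes with a sequence of neighbourhoods of which one is conjugated into \<open>W n\<close> by any given \<open>g\<close>.
  There are countably many such sequences in total, and the next member is chosen inside the first
  \<open>n\<close> terms of the first \<open>n\<close> sequences. The freedom in \<open>U\<close> lets one filtration refine another, or
  have its core inside a given countable intersection of neighbourhoods.\<close>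

theorem nbhd_filtration_exists:
  fixes G (structure)
  assumes G: "topological_group G T" and qib: "quasi_invariant_basis G T"
    and U: "\<And>n. neighbourhood T \<one> (U n)"
  shows "\<exists>W. nbhd_filtration G W T \<and> (\<forall>n. W n \<subseteq> U n)"
proof -
  interpret Group.group G using G by (simp add: topological_group_def)
  have top: "topspace T = carrier G" using G by (simp add: topological_group_def)
  \<comment> \<open>A state is the current member \<open>A\<close> with a sequence \<open>Q\<close> below those of all members so far.\<close>
  define P where "P n = (\<lambda>(A, Q :: nat \<Rightarrow> 'a set). neighbourhood T \<one> A \<and> (\<forall>x\<in>A. inv x \<in> A) \<and>
     A \<subseteq> U n \<and> (\<forall>k. neighbourhood T \<one> (Q k)) \<and> decseq Q \<and>
     (\<forall>g\<in>carrier G. \<exists>k. \<forall>v\<in>Q k. g \<otimes> v \<otimes> inv g \<in> A))" for n :: nat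
  define R where "R n = (\<lambda>(A, Q) (A', Q'). (\<forall>x\<in>A'. \<forall>y\<in>A'. x \<otimes> y \<in> A) \<and> A' \<subseteq> Q n \<and>
     (\<forall>k. Q' k \<subseteq> Q k))" for n :: nat and A A' :: "'a set" and Q Q' :: "nat \<Rightarrow> 'a set"
  have step: "\<exists>A' Q'. P n (A', Q') \<and> (\<forall>x\<in>A'. \<forall>y\<in>A'. x \<otimes> y \<in> B) \<and> (\<forall>k. Q' k \<subseteq> Q k)"
    if B: "neighbourhood T \<one> B" "B \<subseteq> U n" and Q: "\<And>k. neighbourhood T \<one> (Q k)" "decseq Q"
    for n B and Q :: "nat \<Rightarrow> 'a set"
  proof -
    obtain A' where A': "neighbourhood T \<one> A'" "\<And>x. x \<in> A' \<Longrightarrow> inv x \<in> A'"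
      "\<And>x y. \<lbrakk>x \<in> A'; y \<in> A'\<rbrakk> \<Longrightarrow> x \<otimes> y \<in> B"
      using neighbourhood_symmetric_root[OF G B(1)] by metis
    obtain Q'' where Q'': "\<And>k. neighbourhood T \<one> (Q'' k)" "decseq Q''"
      "\<And>g. g \<in> carrier G \<Longrightarrow> \<exists>k. \<forall>v\<in>Q'' k. g \<otimes> v \<otimes> inv g \<in> A'"
      using quasi_invariant_decreasing_sequence[OF qib carrier_not_empty A'(1)] by metis
    have "A' \<subseteq> B"
    proof
      fix x assume x: "x \<in> A'"
      then have "x \<in> carrier G" using A'(1) top by (auto simp: neighbourhood_def)
      then show "x \<in> B" using A'(3)[OF x neighbourhood_mem[OF A'(1)]] by simp
    qed
    moreover have "decseq (\<lambda>k. Q'' k \<inter> Q k)"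
      using Q(2) Q''(2) by (force simp: decseq_def)
    moreover have "\<exists>k. \<forall>v\<in>Q'' k \<inter> Q k. g \<otimes> v \<otimes> inv g \<in> A'" if "g \<in> carrier G" for g
      using Q''(3)[OF that] by blast
    ultimately have "P n (A', \<lambda>k. Q'' k \<inter> Q k)"
      using A'(1,2) B(2) neighbourhood_Int[OF Q''(1) Q(1)] by (auto simp: P_def)
    then show ?thesis using A'(3) by (intro exI[of _ A'] exI[of _ "\<lambda>k. Q'' k \<inter> Q k"]) auto
  qed
  have carr: "neighbourhood T \<one> (carrier G)"
    unfolding neighbourhood_def top[symmetric] using top by blast
  have "\<exists>s. P 0 s" using step[OF U[of 0] order_refl, of "\<lambda>_. carrier G"] carr by (auto simp: decseq_def)
  moreover have "\<exists>s'. P (Suc n) s' \<and> R n s s'" if "P n s" for n s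
  proof -
    obtain A Q where s: "s = (A, Q)" by (cases s)
    have AQ: "neighbourhood T \<one> A" "\<And>k. neighbourhood T \<one> (Q k)" "decseq Q"
      using that by (auto simp: s P_def)
    have "neighbourhood T \<one> (A \<inter> Q n \<inter> U (Suc n))"
      by (intro neighbourhood_Int AQ U)
    from step[OF this _ AQ(2,3)] obtain A' Q' where *: "P (Suc n) (A', Q')"
      "\<forall>x\<in>A'. \<forall>y\<in>A'. x \<otimes> y \<in> A \<inter> Q n \<inter> U (Suc n)" "\<forall>k. Q' k \<subseteq> Q k" by blast
    have "A' \<subseteq> Q n"
    proof
      fix x assume x: "x \<in> A'"
      have "neighbourhood T \<one> A'" using *(1) by (simp add: P_def)
      then have "\<one> \<in> A'" "x \<in> carrier G"
        using x top neighbourhood_mem by (fast, auto simp: neighbourhood_def)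
      moreover from this have "x \<otimes> \<one> \<in> Q n" using *(2) x by blast
      ultimately show "x \<in> Q n" by simp
    qed
    then show ?thesis using * by (intro exI[of _ "(A', Q')"]) (auto simp: s R_def)
  qed
  ultimately obtain f where f: "\<And>n. P n (f n)" "\<And>n. R n (f n) (f (Suc n))"
    using dependent_nat_choice[of P R] by metis
  define W where "W n = fst (f n)" for n
  define Q where "Q n = snd (f n)" for n
  have W: "neighbourhood T \<one> (W n)" "x \<in> W n \<Longrightarrow> inv x \<in> W n" "W n \<subseteq> U n" "decseq (Q n)"
    "g \<in> carrier G \<Longrightarrow> \<exists>k. \<forall>v\<in>Q n k. g \<otimes> v \<otimes> inv g \<in> W n" for n x g
    using f(1)[of n] by (auto simp: P_def W_def Q_def split_def)
  have WQ: "\<lbrakk>x \<in> W (Suc n); y \<in> W (Suc n)\<rbrakk> \<Longrightarrow> x \<otimes> y \<in> W n" "W (Suc n) \<subseteq> Q n n"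
    "Q (Suc n) k \<subseteq> Q n k" for n x y k
    using f(2)[of n] by (auto simp: R_def W_def Q_def split_def)
  have "nbhd_filtration G W T"
  proof (intro nbhd_filtration.intro nbhd_filtration_axioms.intro group_filtration.intro
      group_filtration_axioms.intro G W(1) group_axioms)
    show "W n \<subseteq> carrier G" for n using W(1)[of n] top by (simp add: neighbourhood_def)
    show "\<one> \<in> W n" for n using W(1) by (rule neighbourhood_mem)
    show "inv x \<in> W n" if "x \<in> W n" for x n using W(2) that .
    show "x \<otimes> y \<in> W n" if "x \<in> W (Suc n)" "y \<in> W (Suc n)" for x y n using WQ(1) that .
    show "\<exists>m. \<forall>w\<in>W m. g \<otimes> w \<otimes> inv g \<in> W i" if "g \<in> carrier G" for g i
    proof -
      obtain k where k: "\<forall>v\<in>Q i k. g \<otimes> v \<otimes> inv g \<in> W i" using W(5) \<open>g \<in> carrier G\<close> by blast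
      define n where "n = max i k"
      have "Q n n \<subseteq> Q i n"
        by (rule lift_Suc_antimono_le[of "\<lambda>j. Q j n"]) (auto simp: n_def WQ)
      also have "\<dots> \<subseteq> Q i k" using W(4)[of i] by (auto simp: decseq_def n_def)
      finally have "W (Suc n) \<subseteq> Q i k" using WQ(2) by blast
      then show ?thesis using k by blast
    qed
  qed
  then show ?thesis using W(3) by blast
qed

section \<open>An open mapping theorem\<close>

context nbhd_filtration
begin

text \<open>The step from \<open>x\<^sub>i\<close> must be small also after conjugation by \<open>x\<^sub>i\<close>, as otherwise the sequence would
  only be one-sided Cauchy. The admissible size \<open>m i\<close> therefore depends on the point reached.\<close>

lemma adaptive_limit:
  assumes S: "subgroup S G" and hc: "h_complete (G\<lparr>carrier := S\<rparr>) (subtopology T S)"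
    and xS: "\<And>i. x i \<in> S"
    and step: "\<And>i. inv (x i) \<otimes> x (Suc i) \<in> W (m i + 2)"
    and m: "\<And>i. m i < m (Suc i)"
    and conj: "\<And>i w. w \<in> W (m i) \<Longrightarrow> x i \<otimes> w \<otimes> inv (x i) \<in> W i"
  obtains s where "s \<in> S" "\<And>i. inv (x i) \<otimes> s \<in> W (m i)"
proof -
  have [simp]: "x i \<in> carrier G" for i using xS subgroup.mem_carrier[OF S] by blast
  have "strict_mono m" using m by (simp add: strict_mono_Suc_iff)
  then have mi: "i \<le> m i" for i by (rule strict_mono_imp_increasing)
  have tail': "inv (x i) \<otimes> x (i + d) \<in> W (Suc (m i))" for i d
  proof (induction d arbitrary: i)
    case 0
    then show ?case by (simp add: W_one)
  next
    case (Suc d)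
    have "inv (x (Suc i)) \<otimes> x (Suc i + d) \<in> W (Suc (Suc (m i)))"
      using W_mono[OF Suc[of "Suc i"]] m[of i] by simp
    then have "(inv (x i) \<otimes> x (Suc i)) \<otimes> (inv (x (Suc i)) \<otimes> x (Suc i + d)) \<in> W (Suc (m i))"
      using W_mult[OF step[of i, unfolded add_2_eq_Suc']] by blast
    then show ?case by (simp add: group_normalize)
  qed
  have tail: "inv (x i) \<otimes> x j \<in> W (Suc (m i))" if "i \<le> j" for i j
    using tail'[of i "j - i"] that by simp
  have tail_right: "x j \<otimes> inv (x i) \<in> W i" if "i \<le> j" for i j
    using conj[OF W_Suc[OF tail[OF that]]] by (simp add: group_normalize)
  have "Cauchy_seq x"
    unfolding Cauchy_seq_def
  proof (intro conjI allI)
    fix n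
    have "inv (x j) \<otimes> x k \<in> W n \<and> x j \<otimes> inv (x k) \<in> W n" if "j \<ge> Suc n" "k \<ge> Suc n" for j k
    proof
      have "inv (inv (x (Suc n)) \<otimes> x j) \<otimes> (inv (x (Suc n)) \<otimes> x k) \<in> W (m (Suc n))"
        by (intro W_mult[OF W_inv[OF tail] tail] that)
      then show "inv (x j) \<otimes> x k \<in> W n"
        using W_mono[of _ "m (Suc n)" n] mi[of "Suc n"] by (simp add: group_normalize)
      have "(x j \<otimes> inv (x (Suc n))) \<otimes> inv (x k \<otimes> inv (x (Suc n))) \<in> W n"
        by (intro W_mult[OF tail_right W_inv[OF tail_right]] that)
      then show "x j \<otimes> inv (x k) \<in> W n" by (simp add: group_normalize)
    qed
    then show "\<exists>M. \<forall>j\<ge>M. \<forall>k\<ge>M. inv (x j) \<otimes> x k \<in> W n \<and> x j \<otimes> inv (x k) \<in> W n" by blast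
  qed auto
  then obtain s where s: "s \<in> S" "\<And>n. \<forall>\<^sub>F k in sequentially. inv (x k) \<otimes> s \<in> W n"
    using h_complete_imp_Cauchy_convergent[OF S hc] xS by blast
  have [simp]: "s \<in> carrier G" using s(1) subgroup.mem_carrier[OF S] by blast
  have "inv (x i) \<otimes> s \<in> W (m i)" for i
  proof -
    have "\<forall>\<^sub>F k in sequentially. inv (x k) \<otimes> s \<in> W (Suc (m i)) \<and> i \<le> k"
      by (intro eventually_conj s eventually_ge_at_top)
    then obtain k where k: "inv (x k) \<otimes> s \<in> W (Suc (m i))" "i \<le> k"
      by (metis (mono_tags, lifting) eventually_happens' sequentially_bot)
    have "(inv (x i) \<otimes> x k) \<otimes> (inv (x k) \<otimes> s) \<in> W (m i)"
      by (rule W_mult[OF tail[OF k(2)] k(1)])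
    then show ?thesis by (simp add: group_normalize)
  qed
  with s(1) show ?thesis by (rule that)
qed

text \<open>The Baire category theorem for the filtration topology on an \<open>h\<close>-complete subgroup: if each \<open>A i\<close>
  were nowhere dense, successive translates avoiding \<open>A 0, A 1, \<dots>\<close> would shrink to a point of \<open>S\<close>
  outside all of them.\<close>

lemma Baire_cover:
  assumes S: "subgroup S G" and hc: "h_complete (G\<lparr>carrier := S\<rparr>) (subtopology T S)"
    and cover: "S \<subseteq> (\<Union>i::nat. A i)"
  obtains i x m where "x \<in> S"
    "\<And>y k. \<lbrakk>y \<in> S; inv x \<otimes> y \<in> W m\<rbrakk> \<Longrightarrow> \<exists>z\<in>A i. inv y \<otimes> z \<in> W k"
proof (rule ccontr)
  note somewhere_dense = that
  assume "\<not> thesis"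
  then have nowhere_dense:
    "\<exists>y\<in>S. inv x \<otimes> y \<in> W m \<and> (\<exists>k. \<forall>z\<in>A i. inv y \<otimes> z \<notin> W k)" if x: "x \<in> S" for i x m
    using somewhere_dense[OF x] by metis
  interpret S: subgroup S G by (rule S)
  define P where "P i = (\<lambda>(x, m). x \<in> S \<and> (\<forall>w\<in>W m. x \<otimes> w \<otimes> inv x \<in> W i))" for i
  define R where "R i = (\<lambda>(x, m) (y, m'). inv x \<otimes> y \<in> W (m + 2) \<and> m < m' \<and>
      (\<forall>z\<in>A i. inv y \<otimes> z \<notin> W m'))" for i and m m' :: nat and x y
  have "P 0 (\<one>, 0)" by (simp add: P_def)
  moreover have "\<exists>s'. P (Suc i) s' \<and> R i s s'" if "P i s" for i s
  proof -
    obtain x m where s: "s = (x, m)" by (cases s)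
    have "x \<in> S" using that by (simp add: s P_def)
    then obtain y k where y: "y \<in> S" "inv x \<otimes> y \<in> W (m + 2)" "\<forall>z\<in>A i. inv y \<otimes> z \<notin> W k"
      using nowhere_dense by meson
    obtain m' where m': "m' \<ge> Suc m + k" "\<And>w. w \<in> W m' \<Longrightarrow> y \<otimes> w \<otimes> inv y \<in> W (Suc i)"
      using W_conj_ge[OF S.mem_carrier[OF y(1)]] by metis
    have "inv y \<otimes> z \<notin> W m'" if "z \<in> A i" for z
      using y(3) that m'(1) W_mono[of _ m' k] by auto
    then show ?thesis
      using y m' by (intro exI[of _ "(y, m')"]) (auto simp: s P_def R_def)
  qed
  ultimately obtain f where f: "\<And>i. P i (f i)" "\<And>i. R i (f i) (f (Suc i))"
    using dependent_nat_choice[of P R] by metis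
  define x where "x i = fst (f i)" for i
  define m where "m i = snd (f i)" for i
  have "\<exists>s\<in>S. \<forall>i. inv (x i) \<otimes> s \<in> W (m i)"
  proof (rule adaptive_limit[OF S hc])
    show "x i \<in> S" for i using f(1)[of i] by (auto simp: P_def x_def split_def)
    show "inv (x i) \<otimes> x (Suc i) \<in> W (m i + 2)" "m i < m (Suc i)" for i
      using f(2)[of i] by (auto simp: R_def x_def m_def split_def)
    show "x i \<otimes> w \<otimes> inv (x i) \<in> W i" if "w \<in> W (m i)" for i w
      using f(1)[of i] that by (auto simp: P_def x_def m_def split_def)
  qed blast
  then obtain s where s: "s \<in> S" "\<And>i. inv (x i) \<otimes> s \<in> W (m i)" by blast
  obtain i where "s \<in> A i" using cover s(1) by blast
  then have "inv (x (Suc i)) \<otimes> s \<notin> W (m (Suc i))"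
    using f(2)[of i] by (auto simp: R_def x_def m_def split_def)
  then show False using s(2) by blast
qed

text \<open>If \<open>S\<close> is separable for the topology of \<open>V\<close>, countably many translates of \<open>V (n + 1)\<close> cover it. By
  Baire one of them is dense, for the topology of \<open>W\<close>, in some \<open>x (W m)\<close>, and quotients of its
  elements show that \<open>V n\<close> is dense near the identity.\<close>

lemma almost_open:
  assumes V: "group_filtration G V"
    and S: "subgroup S G" and hc: "h_complete (G\<lparr>carrier := S\<rparr>) (subtopology T S)"
    and D: "countable D" "D \<subseteq> S" "\<And>s. s \<in> S \<Longrightarrow> \<exists>d\<in>D. inv d \<otimes> s \<in> V (Suc n)"
  obtains m where "\<And>s k. \<lbrakk>s \<in> S; s \<in> W m\<rbrakk> \<Longrightarrow> \<exists>v\<in>V n \<inter> S. inv v \<otimes> s \<in> W k"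
proof -
  interpret V: group_filtration G V by (rule V)
  interpret S: subgroup S G by (rule S)
  define A where "A i = {z \<in> S. inv (from_nat_into D i) \<otimes> z \<in> V (Suc n)}" for i
  have "S \<subseteq> (\<Union>i. A i)"
  proof
    fix s assume s: "s \<in> S"
    then obtain d where "d \<in> D" "inv d \<otimes> s \<in> V (Suc n)" using D(3) by blast
    moreover then obtain i where "from_nat_into D i = d" using from_nat_into_surj[OF D(1)] by blast
    ultimately show "s \<in> (\<Union>i. A i)" using s by (auto simp: A_def)
  qed
  then obtain i x m where x: "x \<in> S"
    and dense: "\<And>y k. \<lbrakk>y \<in> S; inv x \<otimes> y \<in> W m\<rbrakk> \<Longrightarrow> \<exists>z\<in>A i. inv y \<otimes> z \<in> W k"
    using Baire_cover[OF S hc, of A] by metis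
  define d where "d = from_nat_into D i"
  have "A i \<noteq> {}" using dense[OF x, of 0] x W_one by auto
  then have "D \<noteq> {}" using D(3)[OF S.one_closed] by blast
  then have "d \<in> D" unfolding d_def by (rule from_nat_into)
  then have dS: "d \<in> S" using D(2) by blast
  show ?thesis
  proof (rule that)
    fix s k assume s: "s \<in> S" "s \<in> W m"
    note [simp] = S.mem_carrier[OF s(1)] S.mem_carrier[OF x] S.mem_carrier[OF dS]
    obtain l where l: "l \<ge> Suc k" "\<And>w. w \<in> W l \<Longrightarrow> inv s \<otimes> w \<otimes> s \<in> W (Suc k)"
      using W_conj_inv_ge[of s "Suc k" "Suc k"] by auto
    obtain a where a: "a \<in> A i" "inv x \<otimes> a \<in> W l"
      using dense[OF x, of l] W_one by auto
    obtain b where b: "b \<in> A i" "inv (x \<otimes> s) \<otimes> b \<in> W l"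
      using dense[of "x \<otimes> s" l] x s by (auto simp: inv_mult_cancel)
    have ab: "a \<in> S" "b \<in> S" using a b by (auto simp: A_def)
    note [simp] = ab[THEN S.mem_carrier]
    \<comment> \<open>\<open>a\<close> approximates \<open>x\<close> and \<open>b\<close> approximates \<open>x s\<close>, so \<open>a\<^sup>-\<^sup>1 b\<close> approximates \<open>s\<close>.\<close>
    have "inv (inv d \<otimes> a) \<otimes> (inv d \<otimes> b) \<in> V n"
      using a(1) b(1) by (intro V.W_mult[OF V.W_inv, of _ n]) (auto simp: A_def d_def)
    then have "inv a \<otimes> b \<in> V n" by (simp add: group_normalize)
    moreover have "inv a \<otimes> b \<in> S" using ab by simp
    moreover have "inv (inv a \<otimes> b) \<otimes> s \<in> W k"
    proof -
      have "inv (inv (x \<otimes> s) \<otimes> b) \<otimes> (inv s \<otimes> (inv x \<otimes> a) \<otimes> s) \<in> W k"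
        by (rule W_mult[OF W_inv[OF W_mono[OF b(2) l(1)]] l(2)[OF a(2)]])
      then show ?thesis by (simp add: group_normalize)
    qed
    ultimately show "\<exists>v\<in>V n \<inter> S. inv v \<otimes> s \<in> W k" by blast
  qed
qed

text \<open>From dense images to images that contain a neighbourhood. Approximating \<open>h\<close> by a single product
  \<open>v\<^sub>1 v\<^sub>2 \<dots>\<close> fails, because the admissible size of \<open>v\<^sub>i\<^sub>+\<^sub>1\<close> depends on \<open>v\<^sub>i\<close> while \<open>v\<^sub>i\<close> would have to be
  chosen with that size in mind. Instead two sequences \<open>p\<^sub>i\<close>, \<open>q\<^sub>i\<close> are built in turn with
  \<open>r\<^sub>i = p\<^sub>i\<^sup>-\<^sup>1 h q\<^sub>i\<close> tending to the identity: a move of \<open>p\<close> makes \<open>r\<close> as small as the already known \<open>q\<close>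
  demands, and the following move of \<open>q\<close> makes it as small as the new \<open>p\<close> demands. In the limit
  \<open>h\<close> and \<open>p q\<^sup>-\<^sup>1\<close> agree modulo the core.\<close>

lemma alternating_approximation:
  assumes V: "nbhd_filtration G V T" and VW: "\<And>n. V n \<subseteq> W n"
    and S: "subgroup S G" and hc: "h_complete (G\<lparr>carrier := S\<rparr>) (subtopology T S)"
    and \<mu>: "\<And>n s k. \<lbrakk>s \<in> S; s \<in> W (\<mu> n)\<rbrakk> \<Longrightarrow> \<exists>v\<in>V n \<inter> S. inv v \<otimes> s \<in> W k"
    and \<mu>_ge: "\<And>n. n \<le> \<mu> n"
    and h: "h \<in> S" "h \<in> W (\<mu> (n + 3))"
  shows "\<exists>v\<in>V n. \<exists>c\<in>core. h = v \<otimes> c"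
proof -
  interpret V: nbhd_filtration G V T by (rule V)
  interpret S: subgroup S G by (rule S)
  have [simp]: "h \<in> carrier G" using h by simp
  \<comment> \<open>The indices \<open>a\<close>, \<open>b\<close> record how small the next moves of \<open>p\<close>, \<open>q\<close> must be. Starting at \<open>n + 1\<close>
    keeps both limits in \<open>V (n + 1)\<close>, hence their quotient in \<open>V n\<close>.\<close>
  define P where "P i = (\<lambda>(p, a, q, b). p \<in> S \<and> q \<in> S \<and> i \<le> a \<and> i \<le> b \<and>
      (\<forall>w\<in>V a. p \<otimes> w \<otimes> inv p \<in> V i) \<and> (\<forall>w\<in>V b. q \<otimes> w \<otimes> inv q \<in> V i) \<and>
      inv p \<otimes> h \<otimes> q \<in> W (\<mu> (a + 2)) \<and>
      (i = 0 \<longrightarrow> p = \<one> \<and> a = Suc n \<and> q = \<one> \<and> b = Suc n))" for i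
  define R where "R (i :: nat) = (\<lambda>(p, a, q, b) (p', a', q', b').
      inv p \<otimes> p' \<in> V (a + 2) \<and> inv q \<otimes> q' \<in> V (b + 2) \<and> a < a' \<and> b < b')"
    for i and a b a' b' :: nat and p q p' q'
  have "P 0 (\<one>, Suc n, \<one>, Suc n)"
    using h V.W_mono[of _ "Suc n" 0] by (simp add: P_def numeral_3_eq_3)
  moreover have "\<exists>s'. P (Suc i) s' \<and> R i s s'" if Ps: "P i s" for i s
  proof -
    obtain p a q b where s: "s = (p, a, q, b)" by (cases s)
    have pq: "p \<in> S" "q \<in> S" "i \<le> a" "i \<le> b" "inv p \<otimes> h \<otimes> q \<in> W (\<mu> (a + 2))"
      using Ps by (auto simp: s P_def)
    note [simp] = pq(1,2)[THEN S.mem_carrier]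
    have "inv p \<otimes> h \<otimes> q \<in> S" using pq h by simp
    then obtain v where v: "v \<in> V (a + 2)" "v \<in> S"
      and v': "inv v \<otimes> (inv p \<otimes> h \<otimes> q) \<in> W (\<mu> (b + 2))"
      using \<mu>[OF _ pq(5), of "\<mu> (b + 2)"] by blast
    have [simp]: "v \<in> carrier G" using v by simp
    obtain a' where a': "a' \<ge> Suc a" "\<And>w. w \<in> V a' \<Longrightarrow> (p \<otimes> v) \<otimes> w \<otimes> inv (p \<otimes> v) \<in> V (Suc i)"
      using V.W_conj_ge[of "p \<otimes> v" "Suc a" "Suc i"] by auto
    \<comment> \<open>Inverting the remainder exchanges the roles of \<open>p\<close> and \<open>q\<close>.\<close>
    let ?r = "inv (inv v \<otimes> (inv p \<otimes> h \<otimes> q))"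
    have "?r \<in> S" "?r \<in> W (\<mu> (b + 2))" using pq h v v' W_inv by simp_all
    then obtain u where u: "u \<in> V (b + 2)" "u \<in> S" and u': "inv u \<otimes> ?r \<in> W (\<mu> (a' + 2))"
      using \<mu> by blast
    have [simp]: "u \<in> carrier G" using u by simp
    obtain b' where b': "b' \<ge> Suc b" "\<And>w. w \<in> V b' \<Longrightarrow> (q \<otimes> u) \<otimes> w \<otimes> inv (q \<otimes> u) \<in> V (Suc i)"
      using V.W_conj_ge[of "q \<otimes> u" "Suc b" "Suc i"] by auto
    have "inv (p \<otimes> v) \<otimes> h \<otimes> (q \<otimes> u) \<in> W (\<mu> (a' + 2))"
      using W_inv[OF u'] by (simp add: group_normalize)
    then have "P (Suc i) (p \<otimes> v, a', q \<otimes> u, b')"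
      using pq v u a' b' by (auto simp: P_def)
    moreover have "R i s (p \<otimes> v, a', q \<otimes> u, b')"
      using v u a' b' by (simp add: s R_def inv_mult_cancel)
    ultimately show ?thesis by blast
  qed
  ultimately obtain f where f: "\<And>i. P i (f i)" "\<And>i. R i (f i) (f (Suc i))"
    using dependent_nat_choice[of P R] by metis
  define p where "p i = fst (f i)" for i
  define a where "a i = fst (snd (f i))" for i
  define q where "q i = fst (snd (snd (f i)))" for i
  define b where "b i = snd (snd (snd (f i)))" for i
  have fP: "p i \<in> S" "q i \<in> S" "i \<le> a i" "i \<le> b i"
    "\<And>w. w \<in> V (a i) \<Longrightarrow> p i \<otimes> w \<otimes> inv (p i) \<in> V i"
    "\<And>w. w \<in> V (b i) \<Longrightarrow> q i \<otimes> w \<otimes> inv (q i) \<in> V i"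
    "inv (p i) \<otimes> h \<otimes> q i \<in> W (\<mu> (a i + 2))" for i
    using f(1)[of i] by (auto simp: P_def p_def q_def a_def b_def split_def)
  have f0: "p 0 = \<one>" "a 0 = Suc n" "q 0 = \<one>" "b 0 = Suc n"
    using f(1)[of 0] by (auto simp: P_def p_def q_def a_def b_def split_def)
  have fR: "inv (p i) \<otimes> p (Suc i) \<in> V (a i + 2)" "inv (q i) \<otimes> q (Suc i) \<in> V (b i + 2)"
    "a i < a (Suc i)" "b i < b (Suc i)" for i
    using f(2)[of i] by (auto simp: R_def p_def q_def a_def b_def split_def)
  obtain p' where p': "p' \<in> S" "\<And>i. inv (p i) \<otimes> p' \<in> V (a i)"
    using V.adaptive_limit[OF S hc fP(1) fR(1,3) fP(5)] by blast
  obtain q' where q': "q' \<in> S" "\<And>i. inv (q i) \<otimes> q' \<in> V (b i)"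
    using V.adaptive_limit[OF S hc fP(2) fR(2,4) fP(6)] by blast
  note [simp] = p'(1)[THEN S.mem_carrier] q'(1)[THEN S.mem_carrier]
    fP(1)[THEN S.mem_carrier] fP(2)[THEN S.mem_carrier]
  have "p' \<in> V (Suc n)" "q' \<in> V (Suc n)" using p'(2)[of 0] q'(2)[of 0] by (auto simp: f0)
  then have "p' \<otimes> inv q' \<in> V n" by (rule V.W_mult[OF _ V.W_inv])
  moreover have "inv p' \<otimes> h \<otimes> q' \<in> core"
  proof -
    have "inv p' \<otimes> h \<otimes> q' \<in> W i" for i
    proof -
      let ?i = "i + 2"
      have "inv (p ?i) \<otimes> p' \<in> W ?i" "inv (q ?i) \<otimes> q' \<in> W ?i"
        using W_mono[of _ _ ?i] VW p'(2)[of ?i] q'(2)[of ?i] fP(3,4)[of ?i] by blast+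
      moreover have "inv (p ?i) \<otimes> h \<otimes> q ?i \<in> W ?i"
        by (rule W_mono[OF fP(7)]) (use fP(3)[of ?i] \<mu>_ge[of "a ?i + 2"] in linarith)
      ultimately have "inv (inv (p ?i) \<otimes> p') \<otimes> (inv (p ?i) \<otimes> h \<otimes> q ?i) \<otimes> (inv (q ?i) \<otimes> q') \<in> W i"
        by (elim W_mult3[OF W_inv])
      then show ?thesis by (simp add: group_normalize)
    qed
    then show ?thesis by (simp add: core_def)
  qed
  then have "q' \<otimes> (inv p' \<otimes> h \<otimes> q') \<otimes> inv q' \<in> core"
    using core_normal by (simp add: normal_inv_iff)
  moreover have "h = (p' \<otimes> inv q') \<otimes> (q' \<otimes> (inv p' \<otimes> h \<otimes> q') \<otimes> inv q')"
    by (simp add: group_normalize)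
  ultimately show ?thesis by blast
qed

end

lemma countable_generate:
  fixes G (structure)
  assumes "Group.group G" "countable A" "A \<subseteq> carrier G"
  shows "countable (generate G A)"
proof -
  interpret Group.group G by fact
  let ?B = "A \<union> (\<lambda>a. inv a) ` A"
  let ?prod = "\<lambda>l. foldr (\<otimes>) l \<one>"
  have closed: "?prod l \<in> carrier G" if "set l \<subseteq> ?B" for l
    using that assms(3) by (induction l) auto
  have append: "?prod (l @ l') = ?prod l \<otimes> ?prod l'" if "set l \<subseteq> ?B" "set l' \<subseteq> ?B" for l l'
    using that
  proof (induction l)
    case (Cons b l)
    have "b \<in> carrier G" using Cons.prems assms(3) by auto
    then show ?case using Cons closed[of l] closed[of l'] by (simp add: m_assoc)
  qed (simp add: closed)
  have "generate G A \<subseteq> ?prod ` lists ?B"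
  proof
    fix x assume "x \<in> generate G A"
    then have "\<exists>l. set l \<subseteq> ?B \<and> x = ?prod l"
    proof induction
      case one
      then show ?case by (intro exI[of _ "[]"]) simp
    next
      case (incl h)
      then show ?case using assms(3) by (intro exI[of _ "[h]"]) auto
    next
      case (inv h)
      then show ?case using assms(3) by (intro exI[of _ "[inv h]"]) auto
    next
      case (eng h1 h2)
      then obtain l1 l2 where "set l1 \<subseteq> ?B" "h1 = ?prod l1" "set l2 \<subseteq> ?B" "h2 = ?prod l2" by blast
      then show ?case using append[of l1 l2] by (intro exI[of _ "l1 @ l2"]) auto
    qed
    then show "x \<in> ?prod ` lists ?B" by (auto simp: lists_eq_set)
  qed
  moreover have "countable (lists ?B)" using assms(2) by (simp add: countable_lists)
  ultimately show ?thesis by (meson countable_subset countable_image)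
qed

lemma subgroup_closure_of:
  fixes G (structure)
  assumes G: "topological_group G T" and D: "subgroup D G"
  shows "subgroup (Abstract_Topology.closure_of T D) G"
proof -
  interpret Group.group G using G by (simp add: topological_group_def)
  interpret D: subgroup D G by (rule D)
  have top: "topspace T = carrier G"
    and m: "continuous_map (prod_topology T T) T (\<lambda>(x, y). x \<otimes> y)"
    and i: "continuous_map T T (\<lambda>x. inv x)"
    using G by (auto simp: topological_group_def)
  let ?C = "Abstract_Topology.closure_of T D"
  have DC: "D \<subseteq> ?C" using D.subset top by (simp add: closure_of_subset)
  show ?thesis
  proof (rule subgroupI)
    show "?C \<subseteq> carrier G" using closure_of_subset_topspace[of T D] top by simp
    show "?C \<noteq> {}" using DC D.one_closed by blast
    show "inv x \<in> ?C" if "x \<in> ?C" for x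
    proof -
      have "inv x \<in> Abstract_Topology.closure_of T ((\<lambda>x. inv x) ` D)"
        using continuous_map_image_closure_subset[OF i, of D] that by blast
      moreover have "(\<lambda>x. inv x) ` D \<subseteq> D" by auto
      ultimately show ?thesis using closure_of_mono by blast
    qed
    show "x \<otimes> y \<in> ?C" if "x \<in> ?C" "y \<in> ?C" for x y
    proof -
      have "(x, y) \<in> Abstract_Topology.closure_of (prod_topology T T) (D \<times> D)"
        using that by (simp add: closure_of_Times)
      then have "x \<otimes> y \<in> Abstract_Topology.closure_of T ((\<lambda>(x, y). x \<otimes> y) ` (D \<times> D))"
        using continuous_map_image_closure_subset[OF m, of "D \<times> D"] by force
      moreover have "(\<lambda>(x, y). x \<otimes> y) ` (D \<times> D) \<subseteq> D" by auto
      ultimately show ?thesis using closure_of_mono by blast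
    qed
  qed
qed

context nbhd_filtration
begin

lemma closure_of_meets_translate:
  assumes s: "s \<in> Abstract_Topology.closure_of T D" and U: "neighbourhood T \<one> U"
  shows "\<exists>d\<in>D. inv s \<otimes> d \<in> U"
proof -
  have sG: "s \<in> carrier G" using s closure_of_subset_topspace[of T D] topspace_T by auto
  obtain O' where O': "openin T O'" "\<one> \<in> O'" "O' \<subseteq> U" using U by (auto simp: neighbourhood_def)
  define B where "B = {y \<in> carrier G. inv s \<otimes> y \<in> O'}"
  have "openin T B"
    using openin_left_translate[OF topological_group O'(1)] sG by (simp add: B_def)
  moreover have "s \<in> B" using sG O' by (simp add: B_def)
  ultimately have "\<exists>d. d \<in> D \<and> d \<in> B" using s by (simp add: in_closure_of)
  then show ?thesis using O'(3) by (auto simp: B_def)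
qed

text \<open>The map from the topology of \<open>V\<close> to the Hausdorff quotient for \<open>W\<close> is open. Failure would be
  witnessed by a sequence \<open>w\<^sub>m\<close> in \<open>W m\<close>. The closed subgroup that the sequence generates is separable
  and, by heredity, \<open>h\<close>-complete, so \<open>almost_open\<close> and
  \<open>alternating_approximation\<close> apply to it and contradict the choice of some \<open>w\<^sub>m\<close>.\<close>

theorem open_mapping:
  assumes hhc: "hereditarily_h_complete G T"
    and V: "nbhd_filtration G V T" and VW: "\<And>n. V n \<subseteq> W n"
  shows "\<exists>m. \<forall>w\<in>W m. \<exists>v\<in>V n. \<exists>c\<in>core. w = v \<otimes> c"
proof (rule ccontr)
  interpret V: nbhd_filtration G V T by (rule V)
  assume "\<not> ?thesis"
  then have "\<forall>m. \<exists>w. w \<in> W m \<and> \<not> (\<exists>v\<in>V n. \<exists>c\<in>core. w = v \<otimes> c)" by blast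
  then obtain w where w: "\<And>m. w m \<in> W m" "\<And>m. \<not> (\<exists>v\<in>V n. \<exists>c\<in>core. w m = v \<otimes> c)" by metis
  define D where "D = generate G (range w)"
  define S where "S = Abstract_Topology.closure_of T D"
  have wG: "range w \<subseteq> carrier G" using w(1) W_closed by blast
  have D: "subgroup D G" unfolding D_def by (rule generate_is_subgroup[OF wG])
  have S: "subgroup S G" unfolding S_def by (rule subgroup_closure_of[OF topological_group D])
  interpret S: subgroup S G by (rule S)
  have DS: "D \<subseteq> S"
    using closure_of_subset subgroup.subset[OF D] topspace_T by (metis S_def)
  have wS: "w m \<in> S" for m using DS generate.incl[of "w m" "range w" G] by (auto simp: D_def)
  have hc: "h_complete (G\<lparr>carrier := S\<rparr>) (subtopology T S)"
    using hhc S unfolding hereditarily_h_complete_def S_def by simp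
  have cD: "countable D" unfolding D_def by (rule countable_generate[OF is_group _ wG]) simp
  have dense: "\<exists>d\<in>D. inv d \<otimes> s \<in> V k" if s: "s \<in> S" for s k
  proof -
    obtain d where d: "d \<in> D" "inv s \<otimes> d \<in> V k"
      using closure_of_meets_translate[of s D] V.W_nbhd s by (auto simp: S_def)
    have "d \<in> carrier G" "s \<in> carrier G" using d DS s by auto
    then show ?thesis using V.W_inv[OF d(2)] d(1) by (auto simp: inv_mult_group)
  qed
  have "\<exists>m\<ge>k. \<forall>s\<in>S \<inter> W m. \<forall>l. \<exists>v\<in>V k \<inter> S. inv v \<otimes> s \<in> W l" for k
  proof -
    obtain m where m: "\<And>s l. \<lbrakk>s \<in> S; s \<in> W m\<rbrakk> \<Longrightarrow> \<exists>v\<in>V k \<inter> S. inv v \<otimes> s \<in> W l"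
      using almost_open[OF V.group_filtration_axioms S hc cD DS dense] by metis
    then show ?thesis using W_mono[of _ "max k m" m] by (intro exI[of _ "max k m"]) auto
  qed
  then obtain \<mu> where \<mu>: "\<And>k. \<mu> k \<ge> k"
    "\<And>k s l. \<lbrakk>s \<in> S; s \<in> W (\<mu> k)\<rbrakk> \<Longrightarrow> \<exists>v\<in>V k \<inter> S. inv v \<otimes> s \<in> W l"
    by (metis IntI)
  have "\<exists>v\<in>V n. \<exists>c\<in>core. w (\<mu> (n + 3)) = v \<otimes> c"
    by (rule alternating_approximation[OF V VW S hc \<mu>(2,1) wS w(1)])
  then show False using w(2) by blast
qed

end

section \<open>Quotients and products of topological groups\<close>

lemma openin_imp_neighbourhood: "\<lbrakk>openin T A; x \<in> A\<rbrakk> \<Longrightarrow> neighbourhood T x A"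
  using openin_subset unfolding neighbourhood_def by blast

lemma rcosets_eq_image: "rcosets\<^bsub>G\<^esub> N = (\<lambda>x. N #>\<^bsub>G\<^esub> x) ` carrier G"
  by (auto simp: RCOSETS_def)

lemma topspace_quotient_topology:
  assumes "topspace T = carrier G"
  shows "topspace (quotient_topology G T N) = carrier (G Mod N)"
proof -
  have "{x \<in> topspace T. N #>\<^bsub>G\<^esub> x \<in> rcosets\<^bsub>G\<^esub> N} = topspace T"
    using assms by (auto simp: rcosets_eq_image)
  then have "openin (quotient_topology G T N) (rcosets\<^bsub>G\<^esub> N)"
    unfolding openin_quotient_topology by (metis openin_topspace order_refl)
  moreover have "topspace (quotient_topology G T N) \<subseteq> rcosets\<^bsub>G\<^esub> N"
    by (rule openin_topspace[of "quotient_topology G T N", unfolded openin_quotient_topology, THEN conjunct1])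
  ultimately show ?thesis
    using openin_subset by (fastforce simp: carrier_FactGroup rcosets_eq_image)
qed

lemma continuous_map_coset:
  assumes "topspace T = carrier G"
  shows "continuous_map T (quotient_topology G T N) (\<lambda>x. N #>\<^bsub>G\<^esub> x)"
  unfolding continuous_map_def topspace_quotient_topology[OF assms]
  using assms by (auto simp: openin_quotient_topology carrier_FactGroup)

lemma open_map_coset:
  assumes G: "topological_group G T" and N: "N \<lhd> G"
  shows "open_map T (quotient_topology G T N) (\<lambda>x. N #>\<^bsub>G\<^esub> x)"
  unfolding open_map_def
proof (intro allI impI)
  fix U assume U: "openin T U"
  interpret N: normal N G by (rule N)
  have top: "topspace T = carrier G" using G by (simp add: topological_group_def)
  have UG: "U \<subseteq> carrier G" using openin_subset[OF U] top by simp
  have "{x \<in> topspace T. N #>\<^bsub>G\<^esub> x \<in> (\<lambda>x. N #>\<^bsub>G\<^esub> x) ` U} = (\<Union>n\<in>N. {x \<in> carrier G. n \<otimes>\<^bsub>G\<^esub> x \<in> U})"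
  proof (intro equalityI subsetI)
    fix x assume "x \<in> {x \<in> topspace T. N #>\<^bsub>G\<^esub> x \<in> (\<lambda>x. N #>\<^bsub>G\<^esub> x) ` U}"
    then obtain u where x: "x \<in> carrier G" and u: "u \<in> U" "N #>\<^bsub>G\<^esub> x = N #>\<^bsub>G\<^esub> u"
      using top by auto
    have "u \<in> N #>\<^bsub>G\<^esub> x" using u UG N.rcos_self[OF _ N.subgroup_axioms] by auto
    then show "x \<in> (\<Union>n\<in>N. {x \<in> carrier G. n \<otimes>\<^bsub>G\<^esub> x \<in> U})"
      using u x by (auto simp: r_coset_def)
  next
    fix x assume "x \<in> (\<Union>n\<in>N. {x \<in> carrier G. n \<otimes>\<^bsub>G\<^esub> x \<in> U})"
    then obtain n where n: "n \<in> N" "x \<in> carrier G" "n \<otimes>\<^bsub>G\<^esub> x \<in> U" by blast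
    then have "n \<otimes>\<^bsub>G\<^esub> x \<in> N #>\<^bsub>G\<^esub> x" by (auto simp: r_coset_def)
    then have "N #>\<^bsub>G\<^esub> x = N #>\<^bsub>G\<^esub> (n \<otimes>\<^bsub>G\<^esub> x)"
      using N.repr_independence n(2) N.subgroup_axioms by blast
    then show "x \<in> {x \<in> topspace T. N #>\<^bsub>G\<^esub> x \<in> (\<lambda>x. N #>\<^bsub>G\<^esub> x) ` U}"
      using n top by auto
  qed
  moreover have "openin T (\<Union>n\<in>N. {x \<in> carrier G. n \<otimes>\<^bsub>G\<^esub> x \<in> U})"
    using openin_left_translate[OF G U] N.mem_carrier by blast
  ultimately show "openin (quotient_topology G T N) ((\<lambda>x. N #>\<^bsub>G\<^esub> x) ` U)"
    using UG by (auto simp: openin_quotient_topology rcosets_eq_image)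
qed

text \<open>The coset map is open, so boxes of open sets in \<open>G\<close> have open images; continuity of the
  operations descends along it.\<close>

lemma topological_group_quotient:
  assumes G: "topological_group G T" and N: "N \<lhd> G"
    and T2: "Hausdorff_space (quotient_topology G T N)"
  shows "topological_group (G Mod N) (quotient_topology G T N)"
proof -
  interpret N: normal N G by (rule N)
  let ?Q = "quotient_topology G T N" and ?q = "\<lambda>x. N #>\<^bsub>G\<^esub> x"
  have top: "topspace T = carrier G"
    and m: "continuous_map (prod_topology T T) T (\<lambda>(x, y). x \<otimes>\<^bsub>G\<^esub> y)"
    and i: "continuous_map T T (\<lambda>x. inv\<^bsub>G\<^esub> x)"
    using G by (auto simp: topological_group_def)
  note topQ = topspace_quotient_topology[OF top, of N]
  have inv: "inv\<^bsub>G Mod N\<^esub> (?q x) = ?q (inv\<^bsub>G\<^esub> x)" if "x \<in> carrier G" for x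
    using that by (subst N.inv_FactGroup) (auto simp: carrier_FactGroup N.rcos_inv)
  have grp: "Group.group (G Mod N)" by (rule N.factorgroup_is_group)
  have "continuous_map ?Q ?Q (\<lambda>C. inv\<^bsub>G Mod N\<^esub> C)"
    unfolding continuous_map_def
  proof (intro conjI allI impI)
    show "(\<lambda>C. inv\<^bsub>G Mod N\<^esub> C) \<in> topspace ?Q \<rightarrow> topspace ?Q"
      using group.inv_closed[OF grp] by (auto simp: topQ)
    fix U assume U: "openin ?Q U"
    have "{x \<in> topspace T. inv\<^bsub>G\<^esub> x \<in> {x \<in> topspace T. ?q x \<in> U}} =
        {x \<in> topspace T. ?q x \<in> {C \<in> topspace ?Q. inv\<^bsub>G Mod N\<^esub> C \<in> U}}"
      by (auto simp: top topQ inv carrier_FactGroup)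
    moreover have "openin T {x \<in> topspace T. inv\<^bsub>G\<^esub> x \<in> {x \<in> topspace T. ?q x \<in> U}}"
      using U by (intro openin_continuous_map_preimage[OF i]) (simp add: openin_quotient_topology)
    ultimately show "openin ?Q {C \<in> topspace ?Q. inv\<^bsub>G Mod N\<^esub> C \<in> U}"
      unfolding openin_quotient_topology by (auto simp: topQ carrier_FactGroup rcosets_eq_image)
  qed
  moreover have "continuous_map (prod_topology ?Q ?Q) ?Q (\<lambda>(C, D). C \<otimes>\<^bsub>G Mod N\<^esub> D)"
    unfolding continuous_map_def
  proof (intro conjI allI impI)
    show "(\<lambda>(C, D). C \<otimes>\<^bsub>G Mod N\<^esub> D) \<in> topspace (prod_topology ?Q ?Q) \<rightarrow> topspace ?Q"
      using monoid.m_closed[OF group.is_monoid[OF grp]] by (auto simp: topQ)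
    fix U assume U: "openin ?Q U"
    let ?P = "{p \<in> topspace (prod_topology ?Q ?Q). (case p of (C, D) \<Rightarrow> C \<otimes>\<^bsub>G Mod N\<^esub> D) \<in> U}"
    have "openin T {x \<in> topspace T. ?q x \<in> U}" using U by (simp add: openin_quotient_topology)
    from openin_continuous_map_preimage[OF m this]
    have pre: "openin (prod_topology T T) {p \<in> topspace (prod_topology T T).
        (case p of (x, y) \<Rightarrow> x \<otimes>\<^bsub>G\<^esub> y) \<in> {x \<in> topspace T. ?q x \<in> U}}" .
    show "openin (prod_topology ?Q ?Q) ?P"
      unfolding openin_prod_topology_alt
    proof (intro allI impI)
      fix C D assume "(C, D) \<in> ?P"
      then obtain x y where xy: "x \<in> carrier G" "y \<in> carrier G" "C = ?q x" "D = ?q y"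
        and "C \<otimes>\<^bsub>G Mod N\<^esub> D \<in> U"
        by (auto simp: topQ carrier_FactGroup)
      then have "(x, y) \<in> {p \<in> topspace (prod_topology T T).
          (case p of (x, y) \<Rightarrow> x \<otimes>\<^bsub>G\<^esub> y) \<in> {x \<in> topspace T. ?q x \<in> U}}"
        by (simp add: top N.rcos_sum)
      then obtain A B where AB: "openin T A" "openin T B" "x \<in> A" "y \<in> B"
        "A \<times> B \<subseteq> {p \<in> topspace (prod_topology T T).
          (case p of (x, y) \<Rightarrow> x \<otimes>\<^bsub>G\<^esub> y) \<in> {x \<in> topspace T. ?q x \<in> U}}"
        using pre unfolding openin_prod_topology_alt by meson
      have "?q ` A \<times> ?q ` B \<subseteq> ?P"
      proof
        fix p assume "p \<in> ?q ` A \<times> ?q ` B"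
        then obtain a b where p: "p = (?q a, ?q b)" "a \<in> A" "b \<in> B" by blast
        then have "a \<in> carrier G" "b \<in> carrier G" "?q (a \<otimes>\<^bsub>G\<^esub> b) \<in> U"
          using AB(5) top by auto
        then show "p \<in> ?P" by (simp add: p topQ carrier_FactGroup N.rcos_sum)
      qed
      moreover have "openin ?Q (?q ` A)" "openin ?Q (?q ` B)"
        using open_map_coset[OF G N] AB unfolding open_map_def by blast+
      ultimately show "\<exists>A B. openin ?Q A \<and> openin ?Q B \<and> C \<in> A \<and> D \<in> B \<and> A \<times> B \<subseteq> ?P"
        using xy AB(3,4) by blast
    qed
  qed
  ultimately show ?thesis
    unfolding topological_group_def using grp topQ T2 by blast
qed

lemma topological_group_product:
  assumes G: "\<And>i. i \<in> I \<Longrightarrow> topological_group (Gs i) (Ts i)"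
  shows "topological_group (product_group I Gs) (product_topology Ts I)"
proof -
  let ?P = "product_topology Ts I"
  have grp: "\<And>i. i \<in> I \<Longrightarrow> Group.group (Gs i)" and top: "\<And>i. i \<in> I \<Longrightarrow> topspace (Ts i) = carrier (Gs i)"
    and m: "\<And>i. i \<in> I \<Longrightarrow> continuous_map (prod_topology (Ts i) (Ts i)) (Ts i) (\<lambda>(x, y). x \<otimes>\<^bsub>Gs i\<^esub> y)"
    and iv: "\<And>i. i \<in> I \<Longrightarrow> continuous_map (Ts i) (Ts i) (\<lambda>x. inv\<^bsub>Gs i\<^esub> x)"
    and T2: "\<And>i. i \<in> I \<Longrightarrow> Hausdorff_space (Ts i)"
    using G by (auto simp: topological_group_def)
  have topP: "topspace ?P = carrier (product_group I Gs)"
    using top by (auto simp: PiE_iff)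
  have "continuous_map (prod_topology ?P ?P) ?P (\<lambda>p. \<lambda>i\<in>I. fst p i \<otimes>\<^bsub>Gs i\<^esub> snd p i)"
    unfolding continuous_map_componentwise
  proof (intro conjI ballI)
    fix i assume i: "i \<in> I"
    have "continuous_map (prod_topology ?P ?P) (prod_topology (Ts i) (Ts i)) (\<lambda>p. (fst p i, snd p i))"
      using continuous_map_compose[OF continuous_map_fst[of ?P ?P] continuous_map_product_projection[OF i, of Ts]]
        continuous_map_compose[OF continuous_map_snd[of ?P ?P] continuous_map_product_projection[OF i, of Ts]]
      by (simp add: continuous_map_pairwise o_def)
    from continuous_map_compose[OF this m[OF i]]
    show "continuous_map (prod_topology ?P ?P) (Ts i) (\<lambda>p. (\<lambda>i\<in>I. fst p i \<otimes>\<^bsub>Gs i\<^esub> snd p i) i)"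
      using i by (simp add: o_def)
  qed auto
  then have "continuous_map (prod_topology ?P ?P) ?P (\<lambda>(x, y). x \<otimes>\<^bsub>product_group I Gs\<^esub> y)"
    by (simp add: split_def)
  moreover have "continuous_map ?P ?P (\<lambda>f. \<lambda>i\<in>I. inv\<^bsub>Gs i\<^esub> f i)"
    unfolding continuous_map_componentwise
  proof (intro conjI ballI)
    fix i assume i: "i \<in> I"
    show "continuous_map ?P (Ts i) (\<lambda>f. (\<lambda>i\<in>I. inv\<^bsub>Gs i\<^esub> f i) i)"
      using continuous_map_compose[OF continuous_map_product_projection[OF i, of Ts] iv[OF i]] i
      by (simp add: o_def)
  qed auto
  then have "continuous_map ?P ?P (\<lambda>f. inv\<^bsub>product_group I Gs\<^esub> f)"
    by (rule continuous_map_eq) (use grp topP in simp)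
  moreover have "Hausdorff_space ?P" using T2 by (simp add: Hausdorff_space_product_topology)
  ultimately show ?thesis
    unfolding topological_group_def using topP grp by simp
qed

section \<open>Metrizable quotients\<close>

context nbhd_filtration
begin

lemma closedin_core: "closedin T core"
proof -
  have "openin filtration_topology (carrier G - core)"
    unfolding openin_filtration_topology
  proof (intro conjI ballI)
    fix x assume "x \<in> carrier G - core"
    then obtain n where x: "x \<in> carrier G" "x \<notin> W n" by (auto simp: core_def)
    have "x \<otimes> w \<in> carrier G - core" if w: "w \<in> W (Suc n)" for w
    proof -
      have "x \<otimes> w \<notin> core"
      proof
        assume "x \<otimes> w \<in> core"
        then have "(x \<otimes> w) \<otimes> inv w \<in> W n"
          using w W_inv by (intro W_mult[of _ n]) (auto simp: core_def)
        then show False using x w by (simp add: m_assoc)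
      qed
      then show ?thesis using x w by simp
    qed
    then show "\<exists>n. \<forall>w\<in>W n. x \<otimes> w \<in> carrier G - core" by blast
  qed auto
  then have "openin T (carrier G - core)" by (rule openin_filtration_imp_openin)
  moreover have "core \<subseteq> carrier G" using W_carrier by (auto simp: core_def)
  ultimately show ?thesis by (simp add: closedin_def topspace_T)
qed

text \<open>This is where openness is used. Given a \<open>T\<close>-neighbourhood \<open>A\<close> of the identity, a filtration \<open>V\<close>
  finer than \<open>W\<close> with \<open>V 0\<close> inside \<open>A\<close> is chosen; the open mapping theorem then places some \<open>W m\<close>
  inside \<open>A\<close> times the core.\<close>

lemma quotient_topology_core:
  assumes hhc: "hereditarily_h_complete G T" and qib: "quasi_invariant_basis G T"
  shows "quotient_topology G T core =
    group_filtration.filtration_topology (G Mod core) (\<lambda>n. (\<lambda>w. core #> w) ` W n)"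
proof -
  interpret N: normal core G by (rule core_normal)
  interpret Q: group_filtration "G Mod core" "\<lambda>n. (\<lambda>w. core #> w) ` W n"
    by (rule quotient_filtration)
  let ?q = "\<lambda>x. core #> x"
  show ?thesis
    unfolding topology_eq
  proof (intro allI iffI)
    fix U assume U: "openin (quotient_topology G T core) U"
    show "openin Q.filtration_topology U"
      unfolding Q.openin_filtration_topology
    proof (intro conjI ballI)
      show "U \<subseteq> carrier (G Mod core)"
        using U by (simp add: openin_quotient_topology carrier_FactGroup rcosets_eq_image)
      fix C assume "C \<in> U"
      then obtain x where x: "x \<in> carrier G" "C = ?q x" "?q x \<in> U"
        using U by (auto simp: openin_quotient_topology rcosets_eq_image)
      define A where "A = {y \<in> carrier G. x \<otimes> y \<in> {x \<in> topspace T. ?q x \<in> U}}"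
      have "openin T A"
        unfolding A_def using U x(1)
        by (intro openin_left_translate[OF topological_group]) (auto simp: openin_quotient_topology)
      then have "neighbourhood T \<one> A"
        by (rule openin_imp_neighbourhood) (use x topspace_T in \<open>simp add: A_def\<close>)
      then have *: "neighbourhood T \<one> (W n \<inter> A)" for n
        by (rule neighbourhood_Int[OF W_nbhd])
      obtain V where V: "nbhd_filtration G V T" "\<And>n. V n \<subseteq> W n \<inter> A"
        using nbhd_filtration_exists[OF topological_group qib, of "\<lambda>n. W n \<inter> A", OF *] by blast
      then obtain m where m: "\<forall>w\<in>W m. \<exists>v\<in>V 0. \<exists>c\<in>core. w = v \<otimes> c"
        using open_mapping[OF hhc V(1), of 0] by blast
      have "C \<otimes>\<^bsub>G Mod core\<^esub> ?q w \<in> U" if w: "w \<in> W m" for w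
      proof -
        obtain v c where v: "v \<in> V 0" "c \<in> core" "w = v \<otimes> c" using m w by blast
        have vA: "v \<in> A" using v V(2) by blast
        then have vG: "v \<in> carrier G" by (simp add: A_def)
        have "?q w = ?q v <#> ?q c" using v vG by (simp add: N.rcos_sum)
        also have "?q c = ?q \<one>" using v by (simp add: N.rcos_const)
        also have "?q v <#> ?q \<one> = ?q v" using vG N.rcos_sum[of v \<one>] by simp
        finally show ?thesis using vA vG x by (simp add: N.rcos_sum A_def)
      qed
      then show "\<exists>n. \<forall>D\<in>?q ` W n. C \<otimes>\<^bsub>G Mod core\<^esub> D \<in> U" by blast
    qed
  next
    fix U assume U: "openin Q.filtration_topology U"
    have "openin filtration_topology {x \<in> topspace T. ?q x \<in> U}"
      unfolding openin_filtration_topology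
    proof (intro conjI ballI)
      fix x assume x: "x \<in> {x \<in> topspace T. ?q x \<in> U}"
      then obtain n where n: "\<forall>D\<in>?q ` W n. ?q x \<otimes>\<^bsub>G Mod core\<^esub> D \<in> U"
        using U unfolding Q.openin_filtration_topology by blast
      have "?q (x \<otimes> w) \<in> U" if "w \<in> W n" for w
        using n that x by (simp add: topspace_T N.rcos_sum)
      then show "\<exists>n. \<forall>w\<in>W n. x \<otimes> w \<in> {x \<in> topspace T. ?q x \<in> U}"
        using x by (auto simp: topspace_T)
    qed (auto simp: topspace_T)
    then show "openin (quotient_topology G T core) U"
      using openin_filtration_imp_openin U
      by (simp add: openin_quotient_topology Q.openin_filtration_topology carrier_FactGroup
          rcosets_eq_image)
  qed
qed

theorem core_metrizable_quotient_kernel: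
  assumes "hereditarily_h_complete G T" "quasi_invariant_basis G T"
  shows "core \<in> metrizable_quotient_kernels G T"
proof -
  interpret Q: group_filtration "G Mod core" "\<lambda>n. (\<lambda>w. core #> w) ` W n"
    by (rule quotient_filtration)
  show ?thesis
    using Q.metrizable_filtration_topology[OF Inter_quotient_filtration]
    by (simp add: metrizable_quotient_kernels_def core_normal closedin_core
        quotient_topology_core[OF assms])
qed

end

text \<open>A point of a metrizable space is a countable intersection of neighbourhoods; this passes to
  preimages under the quotient map.\<close>

lemma metrizable_quotient_kernel_separating_neighbourhoods:
  fixes G (structure)
  assumes G: "topological_group G T" and N: "N \<in> metrizable_quotient_kernels G T"
  shows "\<exists>U. (\<forall>n::nat. neighbourhood T \<one> (U n)) \<and> (\<Inter>n. U n) \<subseteq> N"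
proof -
  have nN: "N \<lhd> G" and mN: "metrizable_space (quotient_topology G T N)"
    using N by (auto simp: metrizable_quotient_kernels_def)
  interpret N: normal N G by (rule nN)
  have top: "topspace T = carrier G" using G by (simp add: topological_group_def)
  obtain M d where M: "Metric_space M d" and Q: "quotient_topology G T N = Metric_space.mtopology M d"
    using mN by (auto simp: metrizable_space_def)
  interpret M: Metric_space M d by (rule M)
  have Mc: "M = carrier (G Mod N)"
    using topspace_quotient_topology[OF top, of N] by (simp add: Q)
  have NM: "N \<in> M" using N.subgroup_in_rcosets by (simp add: Mc carrier_FactGroup rcosets_eq_image)
  have N1: "N #> \<one> = N" using N.coset_mult_one[OF N.subset] .
  define U where "U n = {x \<in> carrier G. N #> x \<in> M.mball N (inverse (real (Suc n)))}" for n
  have "neighbourhood T \<one> (U n)" for n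
  proof -
    have "openin (quotient_topology G T N) (M.mball N (inverse (real (Suc n))))"
      unfolding Q by (rule M.openin_mball)
    then have "openin T (U n)" by (simp add: openin_quotient_topology U_def top)
    moreover have "\<one> \<in> U n" using NM N1 by (simp add: U_def)
    ultimately show ?thesis by (rule openin_imp_neighbourhood)
  qed
  moreover have "(\<Inter>n. U n) \<subseteq> N"
  proof
    fix x assume x: "x \<in> (\<Inter>n. U n)"
    then have xG: "x \<in> carrier G" and xM: "N #> x \<in> M" by (auto simp: U_def)
    have "d N (N #> x) < inverse (real (Suc n))" for n using x by (auto simp: U_def)
    then have "\<not> d N (N #> x) > 0" using reals_Archimedean by (meson less_asym)
    then have "N = N #> x" using M.mdist_pos_eq[OF NM xM] by blast
    then show "x \<in> N" using N.rcos_self[OF xG N.subgroup_axioms] by simp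
  qed
  ultimately show ?thesis by blast
qed

section \<open>The limit of the metrizable quotients\<close>

locale hhc_quasi_invariant =
  fixes G :: "('a, 'b) monoid_scheme" (structure) and T :: "'a topology"
  assumes tg: "topological_group G T"
    and hhc: "hereditarily_h_complete G T"
    and qib: "quasi_invariant_basis G T"
begin

sublocale Group.group G using tg by (simp add: topological_group_def)

abbreviation kernels :: "'a set set" where
  "kernels \<equiv> metrizable_quotient_kernels G T"

lemma topspace_carrier: "topspace T = carrier G"
  using tg by (simp add: topological_group_def)

lemma kernel_inside_neighbourhoods:
  assumes "\<And>n::nat. neighbourhood T \<one> (U n)"
  shows "\<exists>W. nbhd_filtration G W T \<and> (\<forall>n. W n \<subseteq> U n) \<and> (\<Inter>n. W n) \<in> kernels"
proof -
  obtain W where W: "nbhd_filtration G W T" "\<forall>n. W n \<subseteq> U n"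
    using nbhd_filtration_exists[OF tg qib, of U, OF assms] by blast
  interpret W: nbhd_filtration G W T by (rule W(1))
  show ?thesis
    using W W.core_metrizable_quotient_kernel[OF hhc qib] unfolding W.core_def by blast
qed

lemma kernels_nonempty: "kernels \<noteq> {}"
proof -
  have "neighbourhood T \<one> (carrier G)"
    by (rule openin_imp_neighbourhood) (use openin_topspace[of T] topspace_carrier in simp_all)
  then show ?thesis using kernel_inside_neighbourhoods[of "\<lambda>_. carrier G"] by blast
qed

text \<open>Both kernels contain countable intersections of neighbourhoods, so a single filtration has its
  core inside both.\<close>

lemma kernels_directed:
  assumes N: "N \<in> kernels" "N' \<in> kernels"
  shows "\<exists>K\<in>kernels. K \<subseteq> N \<and> K \<subseteq> N'"
proof -
  obtain U where U: "\<And>n::nat. neighbourhood T \<one> (U n)" "(\<Inter>n. U n) \<subseteq> N"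
    using metrizable_quotient_kernel_separating_neighbourhoods[OF tg N(1)] by blast
  obtain U' where U': "\<And>n::nat. neighbourhood T \<one> (U' n)" "(\<Inter>n. U' n) \<subseteq> N'"
    using metrizable_quotient_kernel_separating_neighbourhoods[OF tg N(2)] by blast
  obtain W where W: "\<And>n. W n \<subseteq> U n \<inter> U' n" "(\<Inter>n. W n) \<in> kernels"
    using kernel_inside_neighbourhoods[of "\<lambda>n. U n \<inter> U' n", OF neighbourhood_Int[OF U(1) U'(1)]]
    by blast
  have "(\<Inter>n. W n) \<subseteq> (\<Inter>n. U n)" "(\<Inter>n. W n) \<subseteq> (\<Inter>n. U' n)" using W(1) by blast+
  then have "(\<Inter>n. W n) \<subseteq> N" "(\<Inter>n. W n) \<subseteq> N'" using U(2) U'(2) by (meson subset_trans)+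
  then show ?thesis using W(2) by (intro bexI conjI)
qed

lemma kernels_finite_lower_bound:
  assumes "finite F" "F \<subseteq> kernels"
  shows "\<exists>K\<in>kernels. \<forall>N\<in>F. K \<subseteq> N"
  using assms
proof induction
  case empty
  then show ?case using kernels_nonempty by auto
next
  case (insert N F)
  then obtain K where K: "K \<in> kernels" "\<forall>N\<in>F. K \<subseteq> N" by blast
  obtain L where "L \<in> kernels" "L \<subseteq> K" "L \<subseteq> N"
    using kernels_directed[OF K(1), of N] insert.prems by blast
  then show ?case using K(2) by (intro bexI[of _ L]) blast+
qed

text \<open>Open sets of \<open>T\<close> are seen by metrizable quotients: inside \<open>x\<^sup>-\<^sup>1 U\<close> there is a filtration, and its
  core moves points of \<open>x (W 1)\<close> only within \<open>x (W 0)\<close>. This gives both injectivity and openness of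
  the map to the limit.\<close>

lemma cosets_determine_open_set:
  assumes U: "openin T U" "x \<in> U"
  obtains N B where "N \<in> kernels" "openin T B" "x \<in> B"
    "\<And>y b. \<lbrakk>y \<in> carrier G; b \<in> B; N #> y = N #> b\<rbrakk> \<Longrightarrow> y \<in> U"
proof -
  have x: "x \<in> carrier G" using openin_subset[OF U(1)] U(2) topspace_carrier by blast
  define U' where "U' = {y \<in> carrier G. x \<otimes> y \<in> U}"
  have "openin T U'" unfolding U'_def by (rule openin_left_translate[OF tg U(1) x])
  then have "neighbourhood T \<one> U'"
    by (rule openin_imp_neighbourhood) (use U(2) x in \<open>simp add: U'_def\<close>)
  then obtain W where W: "nbhd_filtration G W T" "\<And>n::nat. W n \<subseteq> U'" "(\<Inter>n. W n) \<in> kernels"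
    using kernel_inside_neighbourhoods[of "\<lambda>_. U'"] by blast
  interpret W: nbhd_filtration G W T by (rule W(1))
  interpret N: normal W.core G by (rule W.core_normal)
  obtain B' where B': "openin T B'" "\<one> \<in> B'" "B' \<subseteq> W 1"
    using W.W_nbhd[of 1] by (auto simp: neighbourhood_def)
  define B where "B = {y \<in> carrier G. inv x \<otimes> y \<in> B'}"
  show ?thesis
  proof (rule that)
    show "W.core \<in> kernels" using W(3) by (simp add: W.core_def)
    show "openin T B" unfolding B_def using x by (intro openin_left_translate[OF tg B'(1)]) simp
    show "x \<in> B" using x B' by (simp add: B_def)
    fix y b assume y: "y \<in> carrier G" and b: "b \<in> B" and eq: "W.core #> y = W.core #> b"
    have bG: "b \<in> carrier G" and bW: "inv x \<otimes> b \<in> W 1" using b B' by (auto simp: B_def)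
    have "y \<in> W.core #> b" using rcos_self[OF y N.subgroup_axioms] eq by simp
    then obtain c where c: "c \<in> W.core" "y = c \<otimes> b" by (auto simp: r_coset_def)
    have cG: "c \<in> carrier G" using c(1) by (rule N.mem_carrier)
    have "inv x \<otimes> c \<otimes> x \<in> W.core" using N.inv_op_closed1[OF x c(1)] .
    then have "(inv x \<otimes> c \<otimes> x) \<otimes> (inv x \<otimes> b) \<in> W 0"
      using bW by (intro W.W_mult[of _ 0]) (auto simp: W.core_def)
    then have "inv x \<otimes> y \<in> U'" using W(2) c cG bG x by (auto simp: group_normalize)
    then show "y \<in> U" using x y by (simp add: U'_def inv_mult_cancel)
  qed
qed

abbreviation quotient_embedding :: "'a \<Rightarrow> 'a set \<Rightarrow> 'a set" where
  "quotient_embedding \<equiv> \<lambda>x. \<lambda>N\<in>kernels. N #> x"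

abbreviation limit_carrier :: "('a set \<Rightarrow> 'a set) set" where
  "limit_carrier \<equiv> projective_limit_carrier kernels (\<lambda>N' N. N \<subseteq> N') (\<lambda>N. G Mod N)
     (quotient_transition G)"

lemma kernel_normal: "N \<in> kernels \<Longrightarrow> N \<lhd> G"
  by (simp add: metrizable_quotient_kernels_def)

lemma topological_group_kernel_quotient:
  "N \<in> kernels \<Longrightarrow> topological_group (G Mod N) (quotient_topology G T N)"
  by (rule topological_group_quotient[OF tg])
    (auto simp: metrizable_quotient_kernels_def metrizable_imp_Hausdorff_space)

lemma projective_system_quotients:
  "projective_system kernels (\<lambda>N' N. N \<subseteq> N') (\<lambda>N. G Mod N) (quotient_topology G T)
     (quotient_transition G)"
  unfolding projective_system_def
proof (intro conjI ballI impI)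
  show "kernels \<noteq> {}" by (rule kernels_nonempty)
  show "\<exists>K\<in>kernels. K \<subseteq> N \<and> K \<subseteq> N'" if "N \<in> kernels" "N' \<in> kernels" for N N'
    using kernels_directed that .
  show "topological_group (G Mod N) (quotient_topology G T N)" if "N \<in> kernels" for N
    using topological_group_kernel_quotient that .
  note trans = quotient_transition_coset[OF kernel_normal kernel_normal]
  show "quotient_transition G N N' \<in> hom (G Mod N) (G Mod N')"
    if N: "N' \<in> kernels" "N \<in> kernels" "N \<subseteq> N'" for N N'
  proof -
    interpret N: normal N G by (rule kernel_normal[OF N(2)])
    interpret N': normal N' G by (rule kernel_normal[OF N(1)])
    show ?thesis
      by (rule homI)
        (auto simp: carrier_FactGroup trans[OF N(2,1,3)] N.rcos_sum N'.rcos_sum)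
  qed
  show "continuous_map (quotient_topology G T N) (quotient_topology G T N') (quotient_transition G N N')"
    if N: "N' \<in> kernels" "N \<in> kernels" "N \<subseteq> N'" for N N'
    unfolding continuous_map_def
  proof (intro conjI allI impI)
    show "quotient_transition G N N' \<in> topspace (quotient_topology G T N) \<rightarrow>
        topspace (quotient_topology G T N')"
      by (auto simp: topspace_quotient_topology topspace_carrier carrier_FactGroup trans[OF N(2,1,3)])
    fix U assume U: "openin (quotient_topology G T N') U"
    let ?A = "{C \<in> topspace (quotient_topology G T N). quotient_transition G N N' C \<in> U}"
    have "{x \<in> topspace T. N #> x \<in> ?A} = {x \<in> topspace T. N' #> x \<in> U}"
      by (auto simp: topspace_quotient_topology topspace_carrier carrier_FactGroup trans[OF N(2,1,3)])
    then show "openin (quotient_topology G T N) ?A"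
      using U unfolding openin_quotient_topology
      by (auto simp: topspace_quotient_topology topspace_carrier carrier_FactGroup rcosets_eq_image)
  qed
  show "quotient_transition G N N C = C" if "N \<in> kernels" "C \<in> carrier (G Mod N)" for N C
    using that trans[of N N] by (auto simp: carrier_FactGroup)
  show "quotient_transition G N' N'' (quotient_transition G N N' C) = quotient_transition G N N'' C"
    if "N'' \<in> kernels" "N' \<in> kernels" "N \<in> kernels" "N' \<subseteq> N'' \<and> N \<subseteq> N'"
      and C: "C \<in> carrier (G Mod N)" for N N' N'' C
  proof -
    obtain x where "x \<in> carrier G" "C = N #> x" using C by (auto simp: carrier_FactGroup)
    moreover have "N \<subseteq> N''" using that by blast
    ultimately show ?thesis using that by (simp add: trans)
  qed
qed auto

lemma quotient_embedding_in_limit: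
  assumes "x \<in> carrier G"
  shows "quotient_embedding x \<in> limit_carrier"
  using assms quotient_transition_coset[OF kernel_normal kernel_normal]
  by (auto simp: projective_limit_carrier_def carrier_FactGroup)

lemma quotient_embedding_mult:
  assumes "x \<in> carrier G" "y \<in> carrier G"
  shows "quotient_embedding (x \<otimes> y) =
    quotient_embedding x \<otimes>\<^bsub>product_group kernels (\<lambda>N. G Mod N)\<^esub> quotient_embedding y"
  using assms normal.rcos_sum[OF kernel_normal] by (auto intro!: restrict_ext)

lemma continuous_map_quotient_embedding:
  "continuous_map T (product_topology (quotient_topology G T) kernels) quotient_embedding"
  unfolding continuous_map_componentwise
  using continuous_map_coset[OF topspace_carrier] by (simp add: image_subset_iff)

text \<open>Here \<open>h\<close>-completeness of \<open>G\<close> itself enters, with the full product of the quotients as target.\<close>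

lemma closedin_quotient_embedding:
  "closedin (product_topology (quotient_topology G T) kernels) (quotient_embedding ` carrier G)"
proof (rule h_complete_imp_closedin[OF tg])
  have "h_complete (G\<lparr>carrier := carrier G\<rparr>) (subtopology T (carrier G))"
    using hhc subgroup_self topspace_carrier closedin_topspace[of T]
    unfolding hereditarily_h_complete_def by metis
  then show "h_complete G T" by (simp add: subtopology_topspace flip: topspace_carrier) (simp add: topspace_carrier)
  show "topological_group (product_group kernels (\<lambda>N. G Mod N)) (product_topology (quotient_topology G T) kernels)"
    by (rule topological_group_product) (rule topological_group_kernel_quotient)
  show "quotient_embedding \<in> hom G (product_group kernels (\<lambda>N. G Mod N))"
    by (rule homI) (use quotient_embedding_mult in \<open>auto simp: carrier_FactGroup\<close>)
  show "continuous_map T (product_topology (quotient_topology G T) kernels) quotient_embedding"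
    by (rule continuous_map_quotient_embedding)
qed

text \<open>A basic open set of the product restricts finitely many coordinates. A kernel \<open>K\<close> below all of
  these has a coset \<open>f K = K x\<close>, and compatibility makes the image of \<open>x\<close> agree with \<open>f\<close> there.\<close>

lemma limit_carrier_in_closure:
  "limit_carrier \<subseteq> Abstract_Topology.closure_of
     (product_topology (quotient_topology G T) kernels) (quotient_embedding ` carrier G)"
proof
  fix f assume f: "f \<in> limit_carrier"
  then have fP: "f \<in> (\<Pi>\<^sub>E N\<in>kernels. carrier (G Mod N))"
    and compat: "\<And>N N'. \<lbrakk>N \<in> kernels; N' \<in> kernels; N \<subseteq> N'\<rbrakk> \<Longrightarrow> quotient_transition G N N' (f N) = f N'"
    by (auto simp: projective_limit_carrier_def)
  show "f \<in> Abstract_Topology.closure_of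
     (product_topology (quotient_topology G T) kernels) (quotient_embedding ` carrier G)"
    unfolding in_closure_of
  proof (intro conjI allI impI)
    show "f \<in> topspace (product_topology (quotient_topology G T) kernels)"
      using fP by (auto simp: topspace_quotient_topology topspace_carrier PiE_iff)
    fix O' assume "f \<in> O' \<and> openin (product_topology (quotient_topology G T) kernels) O'"
    then obtain U where fin: "finite {N \<in> kernels. U N \<noteq> topspace (quotient_topology G T N)}"
      and U: "f \<in> Pi\<^sub>E kernels U" "Pi\<^sub>E kernels U \<subseteq> O'"
      unfolding openin_product_topology_alt by meson
    obtain K where K: "K \<in> kernels"
      "\<forall>N\<in>{N \<in> kernels. U N \<noteq> topspace (quotient_topology G T N)}. K \<subseteq> N"
      using kernels_finite_lower_bound[OF fin] by auto
    obtain x where x: "x \<in> carrier G" "f K = K #> x"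
      using fP K(1) by (auto simp: PiE_iff carrier_FactGroup)
    have "N #> x \<in> U N" if N: "N \<in> kernels" for N
    proof (cases "U N = topspace (quotient_topology G T N)")
      case True
      then show ?thesis
        using x by (simp add: topspace_quotient_topology topspace_carrier carrier_FactGroup)
    next
      case False
      then have "K \<subseteq> N" using K(2) N by blast
      then have "f N = N #> x"
        using compat[OF K(1) N] x quotient_transition_coset[OF kernel_normal kernel_normal] K(1) N by metis
      then show ?thesis using U(1) N by (metis PiE_mem)
    qed
    then have "quotient_embedding x \<in> O'" using U(2) by auto
    then show "\<exists>g. g \<in> quotient_embedding ` carrier G \<and> g \<in> O'" using x by blast
  qed
qed

lemma quotient_embedding_image: "quotient_embedding ` carrier G = limit_carrier"
  using limit_carrier_in_closure closure_of_closedin[OF closedin_quotient_embedding]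
    quotient_embedding_in_limit by blast

lemma inj_on_quotient_embedding: "inj_on quotient_embedding (carrier G)"
proof (rule inj_onI, rule ccontr)
  fix x y assume xy: "x \<in> carrier G" "y \<in> carrier G" "quotient_embedding x = quotient_embedding y" "x \<noteq> y"
  have "Hausdorff_space T" using tg by (simp add: topological_group_def)
  then have "closedin T {y}" using xy topspace_carrier by (simp add: closedin_Hausdorff_singleton)
  then have "openin T (carrier G - {y})" by (simp add: closedin_def topspace_carrier)
  then obtain N B where NB: "N \<in> kernels" "x \<in> B"
    "\<And>z b. \<lbrakk>z \<in> carrier G; b \<in> B; N #> z = N #> b\<rbrakk> \<Longrightarrow> z \<in> carrier G - {y}"
    using cosets_determine_open_set[of "carrier G - {y}" x] xy by (metis Diff_iff singletonD)
  have "N #> y = N #> x" using fun_cong[OF xy(3), of N] NB(1) by simp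
  then show False using NB(3)[OF xy(2) NB(2)] by blast
qed

lemma homeomorphic_map_quotient_embedding:
  "homeomorphic_map T (subtopology (product_topology (quotient_topology G T) kernels) limit_carrier)
     quotient_embedding"
proof (rule bijective_open_imp_homeomorphic_map)
  let ?P = "product_topology (quotient_topology G T) kernels"
  show "continuous_map T (subtopology ?P limit_carrier) quotient_embedding"
    using continuous_map_quotient_embedding quotient_embedding_in_limit
    by (auto simp: continuous_map_in_subtopology topspace_carrier)
  show "quotient_embedding ` topspace T = topspace (subtopology ?P limit_carrier)"
    using continuous_map_image_subset_topspace[OF continuous_map_quotient_embedding]
    by (auto simp: topspace_carrier quotient_embedding_image simp flip: quotient_embedding_image)
  show "inj_on quotient_embedding (topspace T)"
    using inj_on_quotient_embedding by (simp add: topspace_carrier)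
  show "open_map T (subtopology ?P limit_carrier) quotient_embedding"
    unfolding open_map_def
  proof (intro allI impI)
    fix U assume U: "openin T U"
    show "openin (subtopology ?P limit_carrier) (quotient_embedding ` U)"
    proof (subst openin_subopen, intro ballI)
      fix f assume "f \<in> quotient_embedding ` U"
      then obtain x where x: "x \<in> U" "f = quotient_embedding x" by blast
      obtain N B where NB: "N \<in> kernels" "openin T B" "x \<in> B"
        "\<And>y b. \<lbrakk>y \<in> carrier G; b \<in> B; N #> y = N #> b\<rbrakk> \<Longrightarrow> y \<in> U"
        using cosets_determine_open_set[OF U x(1)] by blast
      define A where "A = {g \<in> topspace ?P. g N \<in> (\<lambda>y. N #> y) ` B}"
      have "openin (quotient_topology G T N) ((\<lambda>y. N #> y) ` B)"
        using open_map_coset[OF tg kernel_normal[OF NB(1)]] NB(2) unfolding open_map_def by blast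
      then have A: "openin ?P A"
        unfolding A_def by (rule openin_continuous_map_preimage[OF continuous_map_product_projection[OF NB(1)]])
      have xG: "x \<in> carrier G" using x U openin_subset topspace_carrier by blast
      have "quotient_embedding x \<in> topspace ?P"
        using continuous_map_image_subset_topspace[OF continuous_map_quotient_embedding] xG
          topspace_carrier by blast
      then have "f \<in> limit_carrier \<inter> A"
        using x NB(1,3) quotient_embedding_in_limit[OF xG] by (simp add: A_def)
      moreover have "limit_carrier \<inter> A \<subseteq> quotient_embedding ` U"
      proof
        fix g assume g: "g \<in> limit_carrier \<inter> A"
        then obtain y where y: "y \<in> carrier G" "g = quotient_embedding y"
          unfolding quotient_embedding_image[symmetric] by blast
        then have "N #> y \<in> (\<lambda>y. N #> y) ` B" using g NB(1) by (simp add: A_def)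
        then have "y \<in> U" using NB(4) y(1) by blast
        then show "g \<in> quotient_embedding ` U" using y by blast
      qed
      moreover have "openin (subtopology ?P limit_carrier) (limit_carrier \<inter> A)"
        using A by (rule openin_subtopology_Int2)
      ultimately show "\<exists>A'. openin (subtopology ?P limit_carrier) A' \<and> f \<in> A' \<and> A' \<subseteq> quotient_embedding ` U"
        by blast
    qed
  qed
qed

lemma iso_quotient_embedding:
  "quotient_embedding \<in> iso G (projective_limit_group kernels (\<lambda>N' N. N \<subseteq> N') (\<lambda>N. G Mod N)
     (quotient_transition G))"
  unfolding iso_def
proof (intro CollectI conjI)
  show "quotient_embedding \<in> hom G (projective_limit_group kernels (\<lambda>N' N. N \<subseteq> N') (\<lambda>N. G Mod N)
     (quotient_transition G))"
    by (rule homI)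
      (use quotient_embedding_in_limit quotient_embedding_mult in \<open>simp_all add: projective_limit_group_def\<close>)
  show "bij_betw quotient_embedding (carrier G)
     (carrier (projective_limit_group kernels (\<lambda>N' N. N \<subseteq> N') (\<lambda>N. G Mod N) (quotient_transition G)))"
    using inj_on_quotient_embedding quotient_embedding_image
    by (simp add: projective_limit_group_def bij_betw_def)
qed

end

theorem theorem3p1:
  fixes G :: "('a, 'b) monoid_scheme" and T :: "'a topology"
  assumes "topological_group G T"
    and "hereditarily_h_complete G T"
    and "quasi_invariant_basis G T"
  shows "projective_limit_of_metrizable_quotients G T"
proof -
  interpret hhc_quasi_invariant G T using assms by unfold_locales
  show ?thesis
    unfolding projective_limit_of_metrizable_quotients_def Let_def topological_group_iso_def
      projective_limit_topology_def
    using projective_system_quotients iso_quotient_embedding homeomorphic_map_quotient_embedding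
    by blast
qed

end
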